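(* Let $R$ be a commutative ring, $\delta\in R$, $n\geq 0$, and $X\subseteq\{1,\dots,n\}$. Suppose that either $\delta$ is invertible in $R$, or $|X|<n$. Then $\mathrm{Tor}_i^{\mathcal P_n}(\mathbb 1,\mathcal P_n/J_X)=0$ for all $i>0$.
   Context: $\mathcal P_n=\mathcal P_n(R,\delta)$ is the partition algebra: the free $R$-module with basis the set partitions ("diagrams") of $\{-n,\dots,-1,1,\dots,n\}$ (negative elements are left nodes, positive ones right nodes), with product $d_1d_2$ given by identifying the right nodes of $d_1$ with the left nodes of $d_2$, taking the induced partition of the outer nodes by connectivity, and multiplying by $\delta^c$ where $c$ is the number of components consisting solely of middle nodes. A permutation diagram is one all of whose blocks have the form $\{-i,j\}$. The trivial right $\mathcal P_n$-module $\mathbb 1$ is $R$ with permutation diagrams acting as the identity and all other diagrams as $0$. For $X\subseteq\{1,\dots,n\}$, $J_X\subseteq\mathcal P_n$ is the left ideal spanned by all diagrams in which, among the right nodes labelled by elements of $X$, there is at least one singleton block or at least one pair of distinct nodes lying in the same block. *)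

theory Defs
  imports Main "HOL-Library.Disjoint_Sets"
begin

text \<open>Nodes: left nodes -n..-1, right nodes 1..n.\<close>
definition nodes :: "nat \<Rightarrow> int set" where
  "nodes n = {- int n .. -1} \<union> {1 .. int n}"

definition diagrams :: "nat \<Rightarrow> int set set set" where
  "diagrams n = {d. partition_on (nodes n) d}"

text \<open>Stacking d1 on d2: left nodes of d1 become (0,-i), right nodes of d1 and
  left nodes of d2 are identified as middle nodes (1,i), right nodes of d2 become (2,i).\<close>
definition tag1 :: "int \<Rightarrow> nat \<times> int" where
  "tag1 x = (if x < 0 then (0, x) else (1, x))"

definition tag2 :: "int \<Rightarrow> nat \<times> int" where
  "tag2 x = (if x < 0 then (1, - x) else (2, x))"

definition stack_vertices :: "nat \<Rightarrow> (nat \<times> int) set" where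
  "stack_vertices n = tag1 ` nodes n \<union> tag2 ` nodes n"

definition conn :: "int set set \<Rightarrow> int set set \<Rightarrow> ((nat \<times> int) \<times> (nat \<times> int)) set" where
  "conn d1 d2 = (\<Union>B \<in> (image tag1 ` d1) \<union> (image tag2 ` d2). B \<times> B)\<^sup>*"

definition components :: "nat \<Rightarrow> int set set \<Rightarrow> int set set \<Rightarrow> (nat \<times> int) set set" where
  "components n d1 d2 = stack_vertices n // conn d1 d2"

definition dcomp :: "nat \<Rightarrow> int set set \<Rightarrow> int set set \<Rightarrow> int set set" where
  "dcomp n d1 d2 = {snd ` (C \<inter> {v. fst v \<noteq> 1}) | C.
      C \<in> components n d1 d2 \<and> C \<inter> {v. fst v \<noteq> 1} \<noteq> {}}"

definition nloops :: "nat \<Rightarrow> int set set \<Rightarrow> int set set \<Rightarrow> nat" where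
  "nloops n d1 d2 = card {C \<in> components n d1 d2. \<forall>v\<in>C. fst v = 1}"

text \<open>So the product in P_n of basis diagrams is d1 d2 = delta^(nloops) (dcomp d1 d2).\<close>

definition perm_diagram :: "int set set \<Rightarrow> bool" where
  "perm_diagram d \<longleftrightarrow> (\<forall>B\<in>d. \<exists>i j. i > 0 \<and> j > 0 \<and> B = {- i, j})"

text \<open>Diagrams spanning the left ideal J_X.\<close>
definition inJ :: "nat set \<Rightarrow> int set set \<Rightarrow> bool" where
  "inJ X d \<longleftrightarrow> (\<exists>x\<in>X. {int x} \<in> d) \<or>
     (\<exists>x\<in>X. \<exists>y\<in>X. x \<noteq> y \<and> (\<exists>B\<in>d. int x \<in> B \<and> int y \<in> B))"

text \<open>Basis of the left module P_n / J_X: diagrams not in J_X.\<close>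
definition Mbasis :: "nat \<Rightarrow> nat set \<Rightarrow> int set set set" where
  "Mbasis n X = {d \<in> diagrams n. \<not> inJ X d}"

text \<open>Tensoring the trivial right module 1 with the bar resolution
  P_n \<otimes> P_n^{\<otimes> k} \<otimes> M of M = P_n/J_X (all tensor products over R; P_n and M
  are R-free, so this is a projective resolution) gives the complex with
  C_k = P_n^{\<otimes> k} \<otimes>_R M, an R-free module with basis the pairs (ds, m),
  ds a list of k diagrams and m \<in> Mbasis. Chains are coefficient functions.\<close>

type_synonym bar_index = "int set set list \<times> int set set"

definition chain_basis :: "nat \<Rightarrow> nat set \<Rightarrow> nat \<Rightarrow> bar_index set" where
  "chain_basis n X k = {(ds, m). length ds = k \<and> set ds \<subseteq> diagrams n \<and> m \<in> Mbasis n X}"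

definition bar_chains :: "nat \<Rightarrow> nat set \<Rightarrow> nat \<Rightarrow> (bar_index \<Rightarrow> 'r::comm_ring_1) set" where
  "bar_chains n X k = {f. \<forall>x. x \<notin> chain_basis n X k \<longrightarrow> f x = 0}"

text \<open>Coefficient of y in the differential of the basis element (ds, m):
  d(a1 .. ak | m) = eps(a1) (a2..ak|m) + sum_{i=1}^{k-1} (-1)^i (..|a_i a_{i+1}|..|m)
                    + (-1)^k (a1..a_{k-1} | a_k m).\<close>
definition bar_diff_basis :: "nat \<Rightarrow> 'r::comm_ring_1 \<Rightarrow> nat set \<Rightarrow> bar_index \<Rightarrow> bar_index \<Rightarrow> 'r" where
  "bar_diff_basis n \<delta> X x y = (case x of (ds, m) \<Rightarrow>
     (if ds \<noteq> [] \<and> perm_diagram (hd ds) \<and> y = (tl ds, m) then 1 else 0)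
   + (\<Sum>i\<in>{1..<length ds}.
        if y = (take (i - 1) ds @ [dcomp n (ds ! (i - 1)) (ds ! i)] @ drop (i + 1) ds, m)
        then (- 1) ^ i * \<delta> ^ nloops n (ds ! (i - 1)) (ds ! i) else 0)
   + (if ds \<noteq> [] \<and> \<not> inJ X (dcomp n (last ds) m) \<and> y = (butlast ds, dcomp n (last ds) m)
      then (- 1) ^ length ds * \<delta> ^ nloops n (last ds) m else 0))"

definition bar_d :: "nat \<Rightarrow> 'r::comm_ring_1 \<Rightarrow> nat set \<Rightarrow> nat \<Rightarrow> (bar_index \<Rightarrow> 'r) \<Rightarrow> bar_index \<Rightarrow> 'r" where
  "bar_d n \<delta> X k f y = (\<Sum>x\<in>chain_basis n X k. f x * bar_diff_basis n \<delta> X x y)"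

definition Tor_triv_quot_vanishes :: "nat \<Rightarrow> 'r::comm_ring_1 \<Rightarrow> nat set \<Rightarrow> nat \<Rightarrow> bool" where
  "Tor_triv_quot_vanishes n \<delta> X i \<longleftrightarrow>
     (\<forall>f \<in> bar_chains n X i. (\<forall>y. bar_d n \<delta> X i f y = 0) \<longrightarrow>
        (\<exists>g \<in> bar_chains n X (Suc i). bar_d n \<delta> X (Suc i) g = f))"

end

theory Submission
  imports Defs
begin

text \<open>
  Call a pair \<open>(x, y)\<close> in \<open>X \<times> X\<close> a constraint: \<open>x\<close> is isolated
  if \<open>x = y\<close>, and \<open>x\<close>, \<open>y\<close> lie in the same block otherwise. The diagrams
  satisfying a constraint span a left ideal, and \<open>J_X\<close> is the sum of these ideals. The diagrams
  satisfying every constraint in a set \<open>T\<close> span a left ideal \<open>L_T\<close>. If it is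
  nonzero, then \<open>L_T = P_n e\<close> for a diagram \<open>e\<close> that is idempotent up to an
  invertible scalar, so \<open>L_T\<close> is projective. This is where invertibility of
  \<open>\<delta>\<close> or a node outside \<open>X\<close> is needed. If \<open>T\<close> is nonempty,
  then \<open>e\<close> is not a permutation diagram, so the trivial module tensored with \<open>L_T\<close>
  is zero. Let \<open>M(T, U)\<close> be the quotient of \<open>L_T\<close> by the diagrams satisfying some
  constraint in \<open>U\<close>. The long exact sequences of
  \<open>0 \<rightarrow> M(T \<union> {u}, U) \<rightarrow> M(T, U) \<rightarrow> M(T, U \<union> {u}) \<rightarrow> 0\<close>
  and induction on \<open>U\<close> show that Tor of \<open>M(T, U)\<close> vanishes in positive degrees, and in
  all degrees if \<open>T\<close> is nonempty.
\<close>

section \<open>The bar complex of a twisted monoid algebra\<close>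

locale twisted_monoid =
  fixes D :: "'a set"
    and mul :: "'a \<Rightarrow> 'a \<Rightarrow> 'a" (infixl \<open>\<cdot>\<close> 70)
    and wt :: "'a \<Rightarrow> 'a \<Rightarrow> 'r::comm_ring_1"
    and aug :: "'a \<Rightarrow> 'r"
  assumes finite_D: "finite D"
    and mul_closed: "\<lbrakk>a \<in> D; b \<in> D\<rbrakk> \<Longrightarrow> a \<cdot> b \<in> D"
    and mul_assoc: "\<lbrakk>a \<in> D; b \<in> D; c \<in> D\<rbrakk> \<Longrightarrow> (a \<cdot> b) \<cdot> c = a \<cdot> (b \<cdot> c)"
    and wt_cocycle: "\<lbrakk>a \<in> D; b \<in> D; c \<in> D\<rbrakk> \<Longrightarrow> wt a b * wt (a \<cdot> b) c = wt b c * wt a (b \<cdot> c)"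
    and aug_mul: "\<lbrakk>a \<in> D; b \<in> D\<rbrakk> \<Longrightarrow> wt a b * aug (a \<cdot> b) = aug a * aug b"
begin

text \<open>A generator \<open>a1 | ... | ak | m\<close> of the bar complex is the list
  \<open>[a1, ..., ak, m]\<close>, so that the action on \<open>m\<close> is one more merging of neighbours.\<close>

fun face :: "nat \<Rightarrow> 'a list \<Rightarrow> 'a list" where
  "face 0 xs = tl xs"
| "face (Suc 0) (x # y # xs) = (x \<cdot> y) # xs"
| "face (Suc (Suc i)) (x # xs) = x # face (Suc i) xs"
| "face _ _ = []"

fun face_wt :: "nat \<Rightarrow> 'a list \<Rightarrow> 'r" where
  "face_wt 0 xs = aug (hd xs)"
| "face_wt (Suc 0) (x # y # xs) = wt x y"
| "face_wt (Suc (Suc i)) (x # xs) = face_wt (Suc i) xs"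
| "face_wt _ _ = 0"

section \<open>Simplicial identities for weighted faces\<close>

lemma face_Suc:
  "Suc i < length xs \<Longrightarrow>
    face (Suc i) xs = take i xs @ (xs ! i \<cdot> xs ! Suc i) # drop (Suc (Suc i)) xs"
proof (induction i arbitrary: xs)
  case 0
  then obtain x y zs where "xs = x # y # zs"
    by (cases xs; cases "tl xs") auto
  then show ?case by simp
next
  case (Suc i)
  then show ?case by (cases xs) auto
qed

lemma face_wt_Suc: "Suc i < length xs \<Longrightarrow> face_wt (Suc i) xs = wt (xs ! i) (xs ! Suc i)"
proof (induction i arbitrary: xs)
  case 0
  then obtain x y zs where "xs = x # y # zs"
    by (cases xs; cases "tl xs") auto
  then show ?case by simp
next
  case (Suc i)
  then show ?case by (cases xs) auto
qed

lemma length_face: "i < length xs \<Longrightarrow> length (face i xs) = length xs - 1"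
  by (cases i) (auto simp: face_Suc)

lemma set_face:
  assumes "i < length xs" "set xs \<subseteq> D"
  shows "set (face i xs) \<subseteq> D"
proof (cases i)
  case 0
  then show ?thesis using assms by (cases xs) auto
next
  case (Suc j)
  then have "xs ! j \<in> D" "xs ! Suc j \<in> D"
    using assms nth_mem[of j xs] nth_mem[of "Suc j" xs] by auto
  then show ?thesis
    using assms Suc set_take_subset[of j xs] set_drop_subset[of "Suc (Suc j)" xs]
    by (auto simp: face_Suc mul_closed)
qed

lemma face_append: "i < length xs \<Longrightarrow> face i (xs @ ys) = face i xs @ ys"
  by (cases i) (auto simp: face_Suc nth_append)

lemma face_wt_append: "i < length xs \<Longrightarrow> face_wt i (xs @ ys) = face_wt i xs"
  by (cases i) (auto simp: face_wt_Suc nth_append hd_append)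

lemma face_last: "length xs = Suc k \<Longrightarrow> face (Suc k) (xs @ [e]) = butlast xs @ [last xs \<cdot> e]"
  by (cases xs rule: rev_cases) (auto simp: face_Suc nth_append)

lemma face_wt_last: "length xs = Suc k \<Longrightarrow> face_wt (Suc k) (xs @ [e]) = wt (last xs) e"
  by (cases xs rule: rev_cases) (auto simp: face_wt_Suc nth_append)

text \<open>Merges at disjoint places commute. Two overlapping merges involve three consecutive
  entries and agree by associativity, their weights by the cocycle identity. When the first two
  entries both disappear, \<open>aug_mul\<close> equates merging them first with dropping them one
  by one.\<close>

lemma face_face:
  "\<lbrakk>i \<le> j; Suc j < length xs; set xs \<subseteq> D\<rbrakk> \<Longrightarrow>
    face j (face i xs) = face i (face (Suc j) xs) \<and>
    face_wt i xs * face_wt j (face i xs) = face_wt (Suc j) xs * face_wt i (face (Suc j) xs)"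
proof (induction i arbitrary: j xs)
  case 0
  then obtain x y zs where xs: "xs = x # y # zs"
    by (cases xs; cases "tl xs") auto
  then show ?case
    using 0 aug_mul[of x y] by (cases j) (auto simp: mult.commute)
next
  case (Suc i)
  then obtain x xs' where xs: "xs = x # xs'" by (cases xs) auto
  from Suc obtain j' where j: "j = Suc j'" by (cases j) auto
  show ?case
  proof (cases i)
    case 0
    show ?thesis
    proof (cases j')
      case 0
      with Suc.prems xs j obtain y z zs where "xs = x # y # z # zs"
        by (cases xs'; cases "tl xs'") auto
      then show ?thesis
        using Suc.prems \<open>i = 0\<close> 0 j by (auto simp: mul_assoc wt_cocycle)
    next
      case (Suc j'')
      with Suc.prems xs j obtain y ys where "xs = x # y # ys"
        by (cases xs') auto
      moreover from this Suc.prems j Suc obtain z zs where "ys = z # zs"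
        by (cases ys) auto
      ultimately show ?thesis
        using Suc.prems \<open>i = 0\<close> Suc j by (cases j'') (auto simp: mult.commute)
    qed
  next
    case (Suc i')
    then show ?thesis
      using Suc.IH[of j' xs'] Suc.prems xs j by (cases j') auto
  qed
qed

section \<open>The bar differential and its square\<close>

definition lists_of :: "nat \<Rightarrow> 'a list set" where
  "lists_of k = {xs. set xs \<subseteq> D \<and> length xs = Suc k}"

lemma finite_lists_of: "finite (lists_of k)"
  unfolding lists_of_def by (rule finite_lists_length_eq[OF finite_D])

lemma face_lists_of: "\<lbrakk>xs \<in> lists_of (Suc k); i \<le> Suc k\<rbrakk> \<Longrightarrow> face i xs \<in> lists_of k"
  using length_face[of i xs] set_face[of i xs] by (simp add: lists_of_def)

definition bcoeff :: "nat \<Rightarrow> 'a list \<Rightarrow> 'a list \<Rightarrow> 'r" where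
  "bcoeff k xs ys = (\<Sum>i\<le>k. (- 1) ^ i * (face_wt i xs * of_bool (ys = face i xs)))"

definition bd :: "nat \<Rightarrow> ('a list \<Rightarrow> 'r) \<Rightarrow> 'a list \<Rightarrow> 'r" where
  "bd k f ys = (\<Sum>xs\<in>lists_of k. f xs * bcoeff k xs ys)"

lemma bd_add: "bd k (\<lambda>x. f x + g x) ys = bd k f ys + bd k g ys"
  by (simp add: bd_def algebra_simps sum.distrib)

lemma bd_diff: "bd k (\<lambda>x. f x - g x) ys = bd k f ys - bd k g ys"
  by (simp add: bd_def algebra_simps sum_subtractf)

lemma bd_cong: "(\<And>x. x \<in> lists_of k \<Longrightarrow> f x = g x) \<Longrightarrow> bd k f ys = bd k g ys"
  by (auto simp: bd_def intro!: sum.cong)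

text \<open>The iterated faces cancel in pairs: by \<open>face_face\<close>, first \<open>i\<close>
  then \<open>j\<close> with \<open>i \<le> j\<close> gives the same term as first
  \<open>Suc j\<close> then \<open>i\<close>, and the signs are opposite.\<close>

lemma bcoeff_bcoeff:
  assumes xs: "xs \<in> lists_of (Suc k)"
  shows "(\<Sum>ys\<in>lists_of k. bcoeff (Suc k) xs ys * bcoeff k ys zs) = 0"
proof -
  define a where "a i j = face_wt i xs * (face_wt j (face i xs) * of_bool (zs = face j (face i xs)))"
    for i j
  have a_swap: "a i j = a (Suc j) i" if "i \<le> j" "j \<le> k" for i j
  proof -
    have "Suc j < length xs" "set xs \<subseteq> D" using that xs by (auto simp: lists_of_def)
    from face_face[OF that(1) this] show ?thesis
      by (simp add: a_def mult.assoc[symmetric])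
  qed
  have "(\<Sum>ys\<in>lists_of k. bcoeff (Suc k) xs ys * bcoeff k ys zs)
     = (\<Sum>i\<le>Suc k. \<Sum>ys\<in>lists_of k. of_bool (ys = face i xs) *
          ((- 1) ^ i * face_wt i xs * bcoeff k ys zs))"
    unfolding bcoeff_def[of "Suc k"] sum_distrib_right
    by (subst sum.swap) (simp only: mult_ac)
  also have "\<dots> = (\<Sum>i\<le>Suc k. (- 1) ^ i * face_wt i xs * bcoeff k (face i xs) zs)"
  proof (rule sum.cong[OF refl])
    fix i assume "i \<in> {..Suc k}"
    then have "face i xs \<in> lists_of k" using xs by (simp add: face_lists_of)
    then show "(\<Sum>ys\<in>lists_of k. of_bool (ys = face i xs) * ((- 1) ^ i * face_wt i xs * bcoeff k ys zs))
        = (- 1) ^ i * face_wt i xs * bcoeff k (face i xs) zs"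
      using finite_lists_of[of k] by (simp add: of_bool_def if_distrib[of "\<lambda>x. x * _"] sum.delta cong: if_cong)
  qed
  also have "\<dots> = (\<Sum>i\<le>Suc k. \<Sum>j\<le>k. (- 1) ^ (i + j) * a i j)"
    unfolding bcoeff_def sum_distrib_left a_def power_add
    by (intro sum.cong refl) (simp only: mult_ac)
  also have "\<dots> = (\<Sum>(i,j)\<in>{..Suc k} \<times> {..k}. (- 1) ^ (i + j) * a i j)"
    by (simp only: sum.cartesian_product)
  also have "\<dots> = (\<Sum>(i,j)\<in>{(i,j). i \<le> j \<and> j \<le> k}. (- 1) ^ (i + j) * a i j)
      + (\<Sum>(i,j)\<in>{(i,j). j < i \<and> i \<le> Suc k}. (- 1) ^ (i + j) * a i j)"
  proof -
    have split: "{..Suc k} \<times> {..k} = {(i,j). i \<le> j \<and> j \<le> k} \<union> {(i,j). j < i \<and> i \<le> Suc k}"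
      by auto
    have fin: "finite ({..Suc k} \<times> {..k})" by simp
    have "finite {(i,j). i \<le> j \<and> j \<le> k}" "finite {(i,j). j < i \<and> i \<le> Suc k}"
      by (rule finite_subset[OF _ fin], auto)+
    then show ?thesis unfolding split by (intro sum.union_disjoint) auto
  qed
  \<comment> \<open>The bijection between the two triangles sends \<open>(i, j)\<close> with
    \<open>i \<le> j\<close> to \<open>(Suc j, i)\<close>; the index sum grows by one, hence the
    minus sign.\<close>
  also have "(\<Sum>(i,j)\<in>{(i,j). j < i \<and> i \<le> Suc k}. (- 1) ^ (i + j) * a i j)
     = (\<Sum>(i,j)\<in>{(i,j). i \<le> j \<and> j \<le> k}. - ((- 1) ^ (i + j) * a i j))"
    by (rule sum.reindex_bij_witness[where i = "\<lambda>(i,j). (Suc j, i)" and j = "\<lambda>(i,j). (j, i - 1)"])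
       (auto simp: a_swap add.commute gr0_conv_Suc dest!: less_imp_Suc_add)
  finally show ?thesis
    by (simp add: sum_negf case_prod_unfold)
qed

lemma bd_bd: "bd k (bd (Suc k) f) zs = 0"
proof -
  have "bd k (bd (Suc k) f) zs
      = (\<Sum>xs\<in>lists_of (Suc k). f xs * (\<Sum>ys\<in>lists_of k. bcoeff (Suc k) xs ys * bcoeff k ys zs))"
    unfolding bd_def sum_distrib_right sum_distrib_left
    by (subst sum.swap) (simp only: mult_ac)
  then show ?thesis by (simp add: bcoeff_bcoeff)
qed

text \<open>A set \<open>S\<close> stands for the subquotient module with basis \<open>S\<close>. Its
  differential is \<open>bd\<close> with all terms not ending in \<open>S\<close> discarded. In degree
  \<open>0\<close> the only term of \<open>bd\<close> is the empty list, so every chain is a cycle.\<close>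

definition ends_in :: "'a set \<Rightarrow> 'a list set" where
  "ends_in S = {ys. ys \<noteq> [] \<and> last ys \<in> S}"

definition chains :: "'a set \<Rightarrow> nat \<Rightarrow> ('a list \<Rightarrow> 'r) set" where
  "chains S k = {f. \<forall>xs. xs \<notin> lists_of k \<inter> ends_in S \<longrightarrow> f xs = 0}"

definition exact_at :: "'a set \<Rightarrow> nat \<Rightarrow> bool" where
  "exact_at S k \<longleftrightarrow> (\<forall>f\<in>chains S k. (\<forall>ys\<in>ends_in S. bd k f ys = 0) \<longrightarrow>
     (\<exists>g\<in>chains S (Suc k). \<forall>ys\<in>ends_in S. bd (Suc k) g ys = f ys))"

definition left_stable :: "'a set \<Rightarrow> bool" where
  "left_stable L \<longleftrightarrow> L \<subseteq> D \<and> (\<forall>a\<in>D. \<forall>m\<in>L. a \<cdot> m \<in> L)"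

lemma face_ends_in:
  assumes "left_stable L" "xs \<in> lists_of k" "xs \<in> ends_in L" "i \<le> k" "face i xs \<noteq> []"
  shows "face i xs \<in> ends_in L"
proof (cases i)
  case 0
  then show ?thesis using assms by (cases xs) (auto simp: ends_in_def)
next
  case (Suc j)
  then have len: "Suc j < length xs"
    using assms by (simp add: lists_of_def)
  have D: "xs ! j \<in> D"
    using assms(2) len nth_mem[of j xs] by (auto simp: lists_of_def)
  show ?thesis
  proof (cases "Suc (Suc j) < length xs")
    case True
    then show ?thesis using assms len Suc by (simp add: face_Suc ends_in_def)
  next
    case False
    with len have n: "length xs = Suc (Suc j)" by linarith
    then have "last xs = xs ! Suc j" by (subst last_conv_nth) auto
    then have "last (face i xs) = xs ! j \<cdot> last xs" using n Suc
      by (simp add: face_Suc)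
    then show ?thesis using assms D by (auto simp: ends_in_def left_stable_def)
  qed
qed

text \<open>A face either keeps the last entry or multiplies it on the left, so it stays in a left
  ideal. The only other possibility is the empty list, the face of a list of length one, which is
  therefore excluded.\<close>

lemma bd_support:
  assumes "left_stable L" "\<And>xs. xs \<notin> ends_in L \<Longrightarrow> f xs = 0" "ys \<noteq> []" "ys \<notin> ends_in L"
  shows "bd k f ys = 0"
  unfolding bd_def bcoeff_def
proof (rule sum.neutral, intro ballI)
  fix xs assume xs: "xs \<in> lists_of k"
  show "f xs * (\<Sum>i\<le>k. (- 1) ^ i * (face_wt i xs * of_bool (ys = face i xs))) = 0"
  proof (cases "xs \<in> ends_in L")
    case True
    then have "ys \<noteq> face i xs" if "i \<le> k" for i
      using face_ends_in[OF assms(1) xs True that] assms(3,4) by metis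
    then show ?thesis by simp
  qed (simp add: assms(2))
qed

lemma bd_outside_lists_of:
  assumes "ys \<notin> lists_of k"
  shows "bd (Suc k) f ys = 0"
proof -
  have "bcoeff (Suc k) xs ys = 0" if "xs \<in> lists_of (Suc k)" for xs
    unfolding bcoeff_def using face_lists_of[OF that] assms by (intro sum.neutral) auto
  then show ?thesis by (simp add: bd_def)
qed


section \<open>Exactness for left ideals and their subquotients\<close>

lemma left_stable_Int:
  assumes "\<And>L. L \<in> \<L> \<Longrightarrow> left_stable L"
  shows "left_stable (D \<inter> \<Inter>\<L>)"
  using assms mul_closed by (auto simp: left_stable_def)

lemma left_stable_Union:
  assumes "\<And>L. L \<in> \<L> \<Longrightarrow> left_stable L"
  shows "left_stable (\<Union>\<L>)"
  using assms unfolding left_stable_def by blast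

text \<open>If right multiplication by \<open>e\<close> is, up to the scalar \<open>\<kappa>\<close>, the identity
  of the left ideal spanned by \<open>L\<close>, then appending \<open>e\<close> to a chain is a
  contracting homotopy.\<close>

lemma exact_at_idempotent:
  assumes L: "left_stable L" and e: "e \<in> L"
    and e_id: "\<And>m. m \<in> L \<Longrightarrow> m \<cdot> e = m" "\<And>m. m \<in> L \<Longrightarrow> \<kappa> * wt m e = 1"
    and low: "k > 0 \<or> (\<forall>m\<in>L. aug m = 0)"
  shows "exact_at L k"
  unfolding exact_at_def
proof (intro ballI impI)
  fix f assume f: "f \<in> chains L k" and cycle: "\<forall>ys\<in>ends_in L. bd k f ys = 0"
  have f0: "f xs = 0" if "xs \<notin> ends_in L" for xs
    using f that by (auto simp: chains_def)
  \<comment> \<open>The homotopy needs the full boundary to vanish, not just its part ending in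
    \<open>L\<close>. Stability of \<open>L\<close> settles nonempty lists. The empty list carries a
    coefficient only in degree 0, and there it is a combination of values of \<open>aug\<close> on
    \<open>L\<close>, which \<open>low\<close> makes zero.\<close>
  have cycle_all: "bd k f ys = 0" for ys
  proof (cases "ys \<in> ends_in L")
    case False
    show ?thesis
    proof (cases "ys = []")
      case True
      show ?thesis
      proof (cases k)
        case 0
        have "f xs * bcoeff k xs ys = 0" if "xs \<in> lists_of k" for xs
        proof (cases "xs \<in> ends_in L")
          case in_L: True
          with that 0 obtain m where "xs = [m]" "m \<in> L"
            by (auto simp: lists_of_def ends_in_def length_Suc_conv)
          then show ?thesis using low 0 by (simp add: bcoeff_def)
        qed (simp add: f0)
        then show ?thesis by (simp add: bd_def)
      next
        case (Suc k')
        then show ?thesis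
          using bd_outside_lists_of[of ys k'] True by (simp add: lists_of_def)
      qed
    qed (use bd_support[where f = f, OF L f0 _ False] in auto)
  qed (use cycle in auto)
  \<comment> \<open>\<open>s\<close> is the sign of the last face of a list in degree
    \<open>Suc k\<close>, and \<open>\<kappa>\<close> inverts the weight of that face, so both
    scalars cancel and \<open>f\<close> itself is left over.\<close>
  define s :: 'r where "s = (- 1) ^ Suc k"
  have "s * s = ((- 1) * (- 1)) ^ Suc k" by (simp only: s_def power_mult_distrib)
  then have s_sq: "s * s = 1" by simp
  define g where
    "g xs = (if xs \<noteq> [] \<and> last xs = e then s * \<kappa> * f (butlast xs) else 0)" for xs
  have eD: "e \<in> D" using L e by (auto simp: left_stable_def)
  have g: "g \<in> chains L (Suc k)"
    unfolding chains_def
  proof (intro CollectI allI impI)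
    fix xs assume xs: "xs \<notin> lists_of (Suc k) \<inter> ends_in L"
    show "g xs = 0"
    proof (cases "xs \<noteq> [] \<and> last xs = e")
      case True
      then obtain zs where zs: "xs = zs @ [e]" by (metis append_butlast_last_id)
      with xs e have "xs \<notin> lists_of (Suc k)" by (auto simp: ends_in_def)
      with zs eD have "zs \<notin> lists_of k" by (auto simp: lists_of_def)
      then show ?thesis using f zs by (auto simp: g_def chains_def)
    qed (auto simp: g_def)
  qed
  have "bd (Suc k) g ys = f ys" for ys
  proof -
    have "bd (Suc k) g ys = (\<Sum>xs\<in>(\<lambda>xs. xs @ [e]) ` lists_of k. g xs * bcoeff (Suc k) xs ys)"
      unfolding bd_def
    proof (rule sum.mono_neutral_right[OF finite_lists_of])
      show "(\<lambda>xs. xs @ [e]) ` lists_of k \<subseteq> lists_of (Suc k)"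
        using eD by (auto simp: lists_of_def)
      show "\<forall>xs\<in>lists_of (Suc k) - (\<lambda>xs. xs @ [e]) ` lists_of k.
        g xs * bcoeff (Suc k) xs ys = 0"
      proof
        fix xs assume xs: "xs \<in> lists_of (Suc k) - (\<lambda>xs. xs @ [e]) ` lists_of k"
        have "\<not> (xs \<noteq> [] \<and> last xs = e)"
        proof
          assume "xs \<noteq> [] \<and> last xs = e"
          then obtain zs where zs: "xs = zs @ [e]" by (metis append_butlast_last_id)
          with xs have "zs \<in> lists_of k" by (auto simp: lists_of_def)
          with zs xs show False by auto
        qed
        then show "g xs * bcoeff (Suc k) xs ys = 0" by (simp only: g_def if_False mult_zero_left)
      qed
    qed
    also have "\<dots> = (\<Sum>xs\<in>lists_of k. g (xs @ [e]) * bcoeff (Suc k) (xs @ [e]) ys)"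
      by (subst sum.reindex) (auto simp: inj_on_def)
    also have "\<dots> = (\<Sum>xs\<in>lists_of k. s * \<kappa> * (f xs *
        (if ys \<noteq> [] \<and> last ys = e then bcoeff k xs (butlast ys) else 0)) + f xs * of_bool (ys = xs))"
    proof (rule sum.cong[OF refl])
      fix xs assume xs: "xs \<in> lists_of k"
      then have len: "length xs = Suc k" by (simp add: lists_of_def)
      \<comment> \<open>Every face but the last commutes with appending \<open>e\<close>; the last
        one multiplies the final entry of \<open>xs\<close> by \<open>e\<close>, which leaves it
        unchanged when it lies in \<open>L\<close>.\<close>
      have split: "bcoeff (Suc k) (xs @ [e]) ys =
          (\<Sum>i\<le>k. (- 1) ^ i * (face_wt i xs * of_bool (ys = face i xs @ [e])))
          + s * (wt (last xs) e * of_bool (ys = butlast xs @ [last xs \<cdot> e]))"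
        unfolding bcoeff_def s_def using len
        by (simp add: face_append face_wt_append face_last face_wt_last)
      have first: "(\<Sum>i\<le>k. (- 1) ^ i * (face_wt i xs * of_bool (ys = face i xs @ [e])))
         = (if ys \<noteq> [] \<and> last ys = e then bcoeff k xs (butlast ys) else 0)"
      proof (cases "ys \<noteq> [] \<and> last ys = e")
        case True
        then have "(ys = face i xs @ [e]) = (butlast ys = face i xs)" for i
          by (metis append_butlast_last_id butlast_snoc)
        then show ?thesis using True by (simp add: bcoeff_def)
      next
        case False
        then have "ys \<noteq> face i xs @ [e]" for i by auto
        with False show ?thesis by auto
      qed
      show "g (xs @ [e]) * bcoeff (Suc k) (xs @ [e]) ys = s * \<kappa> * (f xs *
        (if ys \<noteq> [] \<and> last ys = e then bcoeff k xs (butlast ys) else 0)) + f xs * of_bool (ys = xs)"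
      proof (cases "xs \<in> ends_in L")
        case True
        then have "last xs \<in> L" "xs \<noteq> []" by (auto simp: ends_in_def)
        then have "butlast xs @ [last xs \<cdot> e] = xs" "\<kappa> * wt (last xs) e = 1"
          using e_id by auto
        moreover have "s * \<kappa> * f xs * (s * (wt (last xs) e * b))
            = (s * s) * (\<kappa> * wt (last xs) e) * (f xs * b)" for b
          by (simp only: mult_ac)
        ultimately have "s * \<kappa> * f xs *
            (s * (wt (last xs) e * of_bool (ys = butlast xs @ [last xs \<cdot> e])))
          = f xs * of_bool (ys = xs)"
          by (simp only: s_sq mult_1)
        moreover have "g (xs @ [e]) = s * \<kappa> * f xs" by (simp add: g_def)
        ultimately show ?thesis
          unfolding split first by (simp only: distrib_left mult.assoc)
      next
        case False
        then show ?thesis by (simp add: g_def f0)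
      qed
    qed
    \<comment> \<open>The faces that do not touch \<open>e\<close> add up to a multiple of the
      boundary of \<open>f\<close>, which vanishes.\<close>
    also have "\<dots> = s * \<kappa> *
         (if ys \<noteq> [] \<and> last ys = e then bd k f (butlast ys) else 0)
         + (\<Sum>xs\<in>lists_of k. f xs * of_bool (ys = xs))"
      unfolding sum.distrib by (simp add: bd_def sum_distrib_left)
    also have "\<dots> = f ys"
    proof -
      have "(\<Sum>xs\<in>lists_of k. f xs * of_bool (ys = xs)) = (if ys \<in> lists_of k then f ys else 0)"
        using finite_lists_of[of k]
        by (simp add: of_bool_def if_distrib[of "\<lambda>x. _ * x"] cong: if_cong)
      also have "\<dots> = f ys" using f by (auto simp: chains_def)
      finally show ?thesis by (simp add: cycle_all)
    qed
    finally show ?thesis .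
  qed
  with g show "\<exists>g\<in>chains L (Suc k). \<forall>ys\<in>ends_in L. bd (Suc k) g ys = f ys" by blast
qed

text \<open>The long exact sequence of the extension of \<open>L - (B \<union> U)\<close> (quotient) by
  \<open>(L \<inter> B) - U\<close> (submodule).\<close>

lemma exact_at_quotient:
  assumes L: "left_stable L" and B: "left_stable B" and U: "left_stable U"
    and sub: "k > 0 \<Longrightarrow> exact_at (L \<inter> B - U) (k - 1)" and total: "exact_at (L - U) k"
  shows "exact_at (L - (B \<union> U)) k"
  unfolding exact_at_def
proof (intro ballI impI)
  define S S1 S2 where "S = L - U" and "S1 = L \<inter> B - U" and "S2 = L - (B \<union> U)"
  have LB: "left_stable (L \<inter> B)" using L B by (auto simp: left_stable_def)
  fix f assume f: "f \<in> chains (L - (B \<union> U)) k"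
    and cycle: "\<forall>ys\<in>ends_in (L - (B \<union> U)). bd k f ys = 0"
  then have f: "f \<in> chains S2 k" and cycle: "\<forall>ys\<in>ends_in S2. bd k f ys = 0"
    by (simp_all add: S2_def)
  have f0: "f xs = 0" if "xs \<notin> ends_in L" for xs
    using f that by (auto simp: chains_def ends_in_def S2_def)
  \<comment> \<open>This is the connecting homomorphism. Lifted to \<open>S\<close>, the cycle
    \<open>f\<close> has a boundary supported in \<open>S1\<close>. Exactness one degree lower
    bounds it by some \<open>h\<close>, and \<open>f - h\<close> is then a cycle in
    \<open>S\<close>.\<close>
  have "\<exists>h\<in>chains S1 k. \<forall>ys\<in>ends_in S1. bd k h ys = bd k f ys"
  proof (cases k)
    case 0
    have "bd 0 f ys = 0" if "ys \<noteq> []" for ys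
      unfolding bd_def bcoeff_def using that
      by (intro sum.neutral) (auto simp: lists_of_def length_Suc_conv)
    moreover have "bd 0 (\<lambda>_. 0) ys = 0" for ys by (simp add: bd_def)
    ultimately show ?thesis using 0
      by (intro bexI[of _ "\<lambda>_. 0"]) (auto simp: chains_def ends_in_def)
  next
    case (Suc k')
    define p where "p ys = (if ys \<in> ends_in S1 then bd k f ys else 0)" for ys
    define q where "q ys = (if ys \<in> ends_in U then bd k f ys else 0)" for ys
    have p: "p \<in> chains S1 k'"
      using bd_outside_lists_of[of _ k' f] Suc by (auto simp: chains_def p_def)
    have pq: "bd k f ys = p ys + q ys" if ys: "ys \<in> lists_of k'" for ys
    proof -
      have ne: "ys \<noteq> []" using ys by (auto simp: lists_of_def)
      show ?thesis
      proof (cases "ys \<in> ends_in L")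
        case True
        then show ?thesis using cycle ne
          by (auto simp: p_def q_def ends_in_def S1_def S2_def)
      next
        case False
        then have "bd k f ys = 0" using bd_support[where f = f, OF L f0 ne] by blast
        then show ?thesis by (simp add: p_def q_def)
      qed
    qed
    \<comment> \<open>\<open>p\<close> is a cycle because \<open>bd\<close> squares to zero and the
      discarded part \<open>q\<close>, supported in the left ideal \<open>U\<close>, cannot
      contribute to lists ending in \<open>S1\<close>.\<close>
    have "bd k' p ys = 0" if ys: "ys \<in> ends_in S1" for ys
    proof -
      have "0 = bd k' (bd k f) ys" using Suc by (simp add: bd_bd)
      also have "\<dots> = bd k' p ys + bd k' q ys"
        unfolding bd_add[symmetric] by (rule bd_cong) (rule pq)
      also have "bd k' q ys = 0"
        using ys by (intro bd_support[OF U]) (auto simp: q_def ends_in_def S1_def)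
      finally show ?thesis by simp
    qed
    moreover have "exact_at S1 k'" using sub Suc by (simp add: S1_def)
    ultimately obtain h where "h \<in> chains S1 k" "\<forall>ys\<in>ends_in S1. bd k h ys = p ys"
      using p Suc unfolding exact_at_def by blast
    then show ?thesis by (auto simp: p_def)
  qed
  then obtain h where h: "h \<in> chains S1 k" and dh: "\<And>ys. ys \<in> ends_in S1 \<Longrightarrow> bd k h ys = bd k f ys"
    by blast
  have h0: "h xs = 0" if "xs \<notin> ends_in (L \<inter> B)" for xs
    using h that by (auto simp: chains_def ends_in_def S1_def)
  have S12: "S1 \<subseteq> S" "S2 \<subseteq> S" "S - S1 = S2" by (auto simp: S_def S1_def S2_def)
  have "(\<lambda>x. f x - h x) \<in> chains S k"
    using f h S12 by (auto simp: chains_def ends_in_def)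
  moreover have "bd k (\<lambda>x. f x - h x) ys = 0" if ys: "ys \<in> ends_in S" for ys
  proof (cases "ys \<in> ends_in S1")
    case True
    then show ?thesis by (simp add: bd_diff dh)
  next
    case False
    with ys have ys2: "ys \<in> ends_in S2" using S12 by (auto simp: ends_in_def)
    then have "bd k h ys = 0"
      by (intro bd_support[OF LB h0]) (auto simp: ends_in_def S2_def)
    with ys2 cycle show ?thesis by (simp add: bd_diff)
  qed
  ultimately obtain g where g: "g \<in> chains S (Suc k)"
    and dg: "\<And>ys. ys \<in> ends_in S \<Longrightarrow> bd (Suc k) g ys = f ys - h ys"
    using total unfolding exact_at_def S_def[symmetric] by blast
  \<comment> \<open>Projecting \<open>g\<close> to the quotient loses only the part
    \<open>g1\<close>, which ends in the left ideal \<open>L \<inter> B\<close>. Its boundary stays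
    there and is invisible in \<open>S2\<close>.\<close>
  define g1 where "g1 xs = (if xs \<in> ends_in S2 then 0 else g xs)" for xs
  define g2 where "g2 xs = (if xs \<in> ends_in S2 then g xs else 0)" for xs
  have "g2 \<in> chains S2 (Suc k)" using g S12 by (auto simp: chains_def g2_def ends_in_def)
  moreover have "bd (Suc k) g2 ys = f ys" if ys: "ys \<in> ends_in S2" for ys
  proof -
    have "bd (Suc k) g ys = bd (Suc k) g1 ys + bd (Suc k) g2 ys"
      unfolding bd_add[symmetric] by (rule bd_cong) (simp add: g1_def g2_def)
    moreover have "bd (Suc k) g1 ys = 0"
    proof (rule bd_support[OF LB])
      show "g1 xs = 0" if "xs \<notin> ends_in (L \<inter> B)" for xs
        using that g by (auto simp: g1_def chains_def ends_in_def S_def S2_def)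
    qed (use ys in \<open>auto simp: ends_in_def S2_def\<close>)
    moreover have "h ys = 0" using h ys by (auto simp: chains_def ends_in_def S1_def S2_def)
    moreover have "ys \<in> ends_in S" using ys S12 by (auto simp: ends_in_def)
    ultimately show ?thesis using dg[of ys] by simp
  qed
  ultimately show "\<exists>g\<in>chains (L - (B \<union> U)) (Suc k).
      \<forall>ys\<in>ends_in (L - (B \<union> U)). bd (Suc k) g ys = f ys"
    unfolding S2_def by blast
qed

lemma exact_at_complement:
  assumes stable: "\<And>c. c \<in> C \<Longrightarrow> left_stable (B c)" and fin: "finite C"
    and aug: "\<And>c m. c \<in> C \<Longrightarrow> m \<in> B c \<Longrightarrow> aug m = 0"
    and idem: "\<And>T. \<lbrakk>T \<subseteq> C; D \<inter> \<Inter>(B ` T) \<noteq> {}\<rbrakk> \<Longrightarrow> \<exists>e \<kappa>. e \<in> D \<inter> \<Inter>(B ` T) \<and>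
      (\<forall>m\<in>D \<inter> \<Inter>(B ` T). m \<cdot> e = m \<and> \<kappa> * wt m e = 1)"
    and k: "k > 0"
  shows "exact_at (D - \<Union>(B ` C)) k"
proof -
  have step: "exact_at (D \<inter> \<Inter>(B ` T) - \<Union>(B ` U)) k"
    if "finite U" "U \<subseteq> C" "T \<subseteq> C" "k > 0 \<or> T \<noteq> {}" for T U k
    using that
  proof (induction U arbitrary: T k rule: finite_induct)
    case empty
    define L where "L = D \<inter> \<Inter>(B ` T)"
    have L: "left_stable L"
      unfolding L_def using stable empty by (intro left_stable_Int) auto
    have "exact_at L k"
    proof (cases "L = {}")
      case True
      then show ?thesis by (auto simp: exact_at_def chains_def ends_in_def)
    next
      case False
      then obtain e \<kappa> where e: "e \<in> L" "\<forall>m\<in>L. m \<cdot> e = m \<and> \<kappa> * wt m e = 1"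
        using idem[OF \<open>T \<subseteq> C\<close>] unfolding L_def by blast
      have low: "k > 0 \<or> (\<forall>m\<in>L. aug m = 0)"
      proof (cases "k > 0")
        case False
        with empty obtain c where "c \<in> T" "c \<in> C" by auto
        then show ?thesis using aug by (auto simp: L_def)
      qed simp
      show ?thesis
        by (rule exact_at_idempotent[OF L e(1) _ _ low]) (use e(2) in auto)
    qed
    then show ?case by (simp add: L_def)
  next
    case (insert u U)
    define L where "L = D \<inter> \<Inter>(B ` T)"
    have L: "left_stable L"
      unfolding L_def using stable insert by (intro left_stable_Int) auto
    have u: "left_stable (B u)"
      using insert.prems by (intro stable) simp
    have Us: "left_stable (\<Union>(B ` U))"
      using insert.prems stable by (intro left_stable_Union) auto
    \<comment> \<open>For \<open>k = 0\<close> the truncated \<open>k - 1\<close> is again 0, which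
      is covered because \<open>insert u T\<close> is nonempty.\<close>
    have sub: "exact_at (L \<inter> B u - \<Union>(B ` U)) (k - 1)"
    proof -
      have "L \<inter> B u = D \<inter> \<Inter>(B ` insert u T)" by (auto simp: L_def)
      then show ?thesis
        using insert.IH[of "insert u T" "k - 1"] insert.prems by auto
    qed
    have total: "exact_at (L - \<Union>(B ` U)) k"
      using insert.IH[of T k] insert.prems by (auto simp: L_def)
    show ?case
      using exact_at_quotient[OF L u Us sub total] by (simp add: L_def)
  qed
  from step[OF fin subset_refl, of "{}"] k show ?thesis by simp
qed

end

section \<open>Components of stacked graphs\<close>

text \<open>When \<open>M\<close> consists of middle nodes, these are the loops that a product of
  diagrams discards.\<close>

definition closed_comps :: "('v \<times> 'v) set \<Rightarrow> 'v set \<Rightarrow> 'v set set" where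
  "closed_comps R M = {R `` {v} |v. v \<in> M \<and> R `` {v} \<subseteq> M}"

lemma rtrancl_map_prod_inj:
  assumes "inj f"
  shows "(f u, w) \<in> (map_prod f f ` R)\<^sup>* \<longleftrightarrow> (\<exists>v. w = f v \<and> (u, v) \<in> R\<^sup>*)"
proof
  assume "(f u, w) \<in> (map_prod f f ` R)\<^sup>*"
  then show "\<exists>v. w = f v \<and> (u, v) \<in> R\<^sup>*"
  proof (induction rule: rtrancl_induct)
    case (step y z)
    then obtain v v' z' where "y = f v" "(u, v) \<in> R\<^sup>*" "y = f v'" "z = f z'" "(v', z') \<in> R"
      by auto
    then show ?case using assms by (metis injD rtrancl_into_rtrancl)
  qed auto
next
  assume "\<exists>v. w = f v \<and> (u, v) \<in> R\<^sup>*"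
  then obtain v where "w = f v" "(u, v) \<in> R\<^sup>*" by blast
  from this(2) have "(f u, f v) \<in> (map_prod f f ` R)\<^sup>*"
    by (induction rule: rtrancl_induct) (auto intro: rtrancl_into_rtrancl)
  then show "(f u, w) \<in> (map_prod f f ` R)\<^sup>*" using \<open>w = f v\<close> by simp
qed

lemma card_closed_comps_map:
  assumes "inj f"
  shows "card (closed_comps ((map_prod f f ` R)\<^sup>*) (f ` M)) = card (closed_comps (R\<^sup>*) M)"
proof -
  have im: "(map_prod f f ` R)\<^sup>* `` {f v} = f ` (R\<^sup>* `` {v})" for v
    using rtrancl_map_prod_inj[OF assms, of v _ R] by auto
  have "closed_comps ((map_prod f f ` R)\<^sup>*) (f ` M) = image f ` closed_comps (R\<^sup>*) M"
  proof -
    have "closed_comps ((map_prod f f ` R)\<^sup>*) (f ` M)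
        = {(map_prod f f ` R)\<^sup>* `` {f v} |v. v \<in> M \<and> (map_prod f f ` R)\<^sup>* `` {f v} \<subseteq> f ` M}"
      unfolding closed_comps_def by blast
    also have "\<dots> = image f ` closed_comps (R\<^sup>*) M"
      unfolding im inj_image_subset_iff[OF assms] closed_comps_def by blast
    finally show ?thesis .
  qed
  moreover have "inj_on (image f) (closed_comps (R\<^sup>*) M)"
    using assms by (meson inj_image_eq_iff inj_onI)
  ultimately show ?thesis by (simp add: card_image)
qed

text \<open>Composing diagrams replaces a graph \<open>R\<close> by its connectivity outside the middle
  nodes \<open>M\<close>. Associativity holds because this does not change the connectivity of
  \<open>R \<union> S\<close> for a graph \<open>S\<close> not touching \<open>M\<close>.\<close>

lemma rtrancl_contract:
  assumes S: "Field S \<inter> M = {}" and u: "u \<notin> M"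
  shows "(u, v) \<in> (R \<union> S)\<^sup>* \<longleftrightarrow>
    (\<exists>w. w \<notin> M \<and> (u, w) \<in> (Restr (R\<^sup>*) (- M) \<union> S)\<^sup>* \<and> (w, v) \<in> R\<^sup>*)"
proof
  assume "(u, v) \<in> (R \<union> S)\<^sup>*"
  then show "\<exists>w. w \<notin> M \<and> (u, w) \<in> (Restr (R\<^sup>*) (- M) \<union> S)\<^sup>* \<and> (w, v) \<in> R\<^sup>*"
  proof (induction rule: rtrancl_induct)
    case base
    then show ?case using u by blast
  next
    case (step y z)
    then obtain w where w: "w \<notin> M" "(u, w) \<in> (Restr (R\<^sup>*) (- M) \<union> S)\<^sup>*" "(w, y) \<in> R\<^sup>*" by blast
    show ?case
    proof (cases "(y, z) \<in> R")
      case True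
      then show ?thesis using w by (meson rtrancl_into_rtrancl)
    next
      case False
      then have yz: "(y, z) \<in> S" using step by blast
      then have "y \<notin> M" "z \<notin> M" using S by (auto simp: Field_def)
      \<comment> \<open>An edge of \<open>S\<close> starts outside \<open>M\<close>, so the
        preceding stretch inside \<open>R\<close> has both ends outside \<open>M\<close> and
        contracts to one edge.\<close>
      then have "(w, y) \<in> Restr (R\<^sup>*) (- M)" using w by auto
      then have "(u, z) \<in> (Restr (R\<^sup>*) (- M) \<union> S)\<^sup>*"
        using w yz by (meson UnI1 UnI2 rtrancl_into_rtrancl)
      then show ?thesis using \<open>z \<notin> M\<close> by blast
    qed
  qed
next
  have R: "R\<^sup>* \<subseteq> (R \<union> S)\<^sup>*" by (simp add: rtrancl_mono)
  have "Restr (R\<^sup>*) (- M) \<union> S \<subseteq> (R \<union> S)\<^sup>*" using R by auto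
  then have "(Restr (R\<^sup>*) (- M) \<union> S)\<^sup>* \<subseteq> (R \<union> S)\<^sup>*"
    by (metis rtrancl_mono rtrancl_idemp)
  moreover assume "\<exists>w. w \<notin> M \<and> (u, w) \<in> (Restr (R\<^sup>*) (- M) \<union> S)\<^sup>* \<and> (w, v) \<in> R\<^sup>*"
  ultimately show "(u, v) \<in> (R \<union> S)\<^sup>*" using R by (meson rtrancl_trans subsetD)
qed

lemma rtrancl_contract_outer:
  assumes S: "Field S \<inter> M = {}" and uv: "u \<notin> M" "v \<notin> M"
  shows "(u, v) \<in> (R \<union> S)\<^sup>* \<longleftrightarrow> (u, v) \<in> (Restr (R\<^sup>*) (- M) \<union> S)\<^sup>*"
proof
  assume "(u, v) \<in> (R \<union> S)\<^sup>*"
  then obtain w where "w \<notin> M" "(u, w) \<in> (Restr (R\<^sup>*) (- M) \<union> S)\<^sup>*" "(w, v) \<in> R\<^sup>*"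
    using rtrancl_contract[OF S uv(1), where R = R] by blast
  moreover from this uv have "(w, v) \<in> Restr (R\<^sup>*) (- M) \<union> S" by auto
  ultimately show "(u, v) \<in> (Restr (R\<^sup>*) (- M) \<union> S)\<^sup>*" by (meson rtrancl_into_rtrancl)
next
  assume "(u, v) \<in> (Restr (R\<^sup>*) (- M) \<union> S)\<^sup>*"
  then show "(u, v) \<in> (R \<union> S)\<^sup>*" using rtrancl_contract[OF S uv(1), where R = R] uv(2) by blast
qed

lemma equiv_class_sym:
  assumes "sym R" "(u, v) \<in> R\<^sup>*"
  shows "R\<^sup>* `` {u} = R\<^sup>* `` {v}"
  using assms sym_rtrancl[OF assms(1)] by (auto dest: symD intro: rtrancl_trans)

lemma closed_comps_memD:
  assumes "sym R" "C \<in> closed_comps (R\<^sup>*) M" "v \<in> C"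
  shows "C = R\<^sup>* `` {v}" "C \<subseteq> M"
  using assms equiv_class_sym[OF assms(1)] by (auto simp: closed_comps_def)

lemma finite_closed_comps: "finite M \<Longrightarrow> finite (closed_comps R M)"
  by (rule finite_subset[of _ "(\<lambda>v. R `` {v}) ` M"]) (auto simp: closed_comps_def)

text \<open>This makes loop counts additive under contraction. A component inside
  \<open>M \<union> N\<close> that avoids \<open>N\<close> is a component of \<open>R\<close> inside
  \<open>M\<close>. One that meets \<open>N\<close> becomes, after deleting \<open>M\<close>, a
  component of the contracted graph, and any of its nodes in \<open>N\<close> determines it.\<close>

lemma card_closed_comps_contract:
  assumes symR: "sym R" and symS: "sym S" and S: "Field S \<inter> M = {}"
    and MN: "M \<inter> N = {}" and fin: "finite M" "finite N"
  shows "card (closed_comps ((R \<union> S)\<^sup>*) (M \<union> N)) =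
    card (closed_comps (R\<^sup>*) M) + card (closed_comps ((Restr (R\<^sup>*) (- M) \<union> S)\<^sup>*) N)"
proof -
  define R' where "R' = Restr (R\<^sup>*) (- M) \<union> S"
  define A where "A = closed_comps ((R \<union> S)\<^sup>*) (M \<union> N)"
  define A1 A2 where "A1 = {C \<in> A. C \<inter> N = {}}" and "A2 = {C \<in> A. C \<inter> N \<noteq> {}}"
  have sym: "sym (R \<union> S)" using symR symS by (simp add: sym_Un)
  have finA: "finite A" unfolding A_def using fin by (simp add: finite_closed_comps)
  have card_A: "card A = card A1 + card A2"
    by (subst card_Un_disjoint[symmetric]) (auto simp: A1_def A2_def finA intro!: arg_cong[of _ _ card])
  have R_sub: "R\<^sup>* \<subseteq> (R \<union> S)\<^sup>*" by (simp add: rtrancl_mono)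
  \<comment> \<open>No edge of \<open>S\<close> touches \<open>M\<close>, so a component of
    \<open>R\<close> inside \<open>M\<close> cannot grow.\<close>
  have inner: "(R \<union> S)\<^sup>* `` {v} = R\<^sup>* `` {v}" if "R\<^sup>* `` {v} \<subseteq> M" for v
  proof -
    have "(v, w) \<in> R\<^sup>*" if "(v, w) \<in> (R \<union> S)\<^sup>*" for w
      using that
    proof (induction rule: rtrancl_induct)
      case (step y z)
      with \<open>R\<^sup>* `` {v} \<subseteq> M\<close> have "y \<in> M" by auto
      then have "(y, z) \<in> R" using S step by (auto simp: Field_def)
      then show ?case using step by auto
    qed auto
    then show ?thesis using R_sub by auto
  qed
  have inner': "R\<^sup>* `` {v} = (R \<union> S)\<^sup>* `` {v}" if "(R \<union> S)\<^sup>* `` {v} \<subseteq> M" for v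
    using inner[of v] that R_sub by blast
  have A1: "A1 = closed_comps (R\<^sup>*) M"
  proof (intro equalityI subsetI)
    fix C assume "C \<in> A1"
    then obtain v where "C = (R \<union> S)\<^sup>* `` {v}" "C \<subseteq> M"
      by (auto simp: A1_def A_def closed_comps_def)
    then show "C \<in> closed_comps (R\<^sup>*) M"
      using inner'[of v] by (auto simp: closed_comps_def intro!: exI[of _ v])
  next
    fix C assume "C \<in> closed_comps (R\<^sup>*) M"
    then obtain v where v: "C = R\<^sup>* `` {v}" "C \<subseteq> M" "v \<in> M"
      by (auto simp: closed_comps_def)
    then have "C = (R \<union> S)\<^sup>* `` {v}" using inner[of v] by simp
    with v MN show "C \<in> A1"
      unfolding A1_def A_def closed_comps_def by blast
  qed
  have outer: "(R \<union> S)\<^sup>* `` {v} - M = R'\<^sup>* `` {v}" if "v \<notin> M" for v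
  proof -
    have "w \<notin> M" if "(v, w) \<in> R'\<^sup>*" for w
      using that \<open>v \<notin> M\<close> S by (induction rule: rtrancl_induct) (auto simp: R'_def Field_def)
    then show ?thesis
      using rtrancl_contract_outer[OF S that, where R = R] by (auto simp: R'_def)
  qed
  have "(\<lambda>C. C - M) ` A2 = closed_comps (R'\<^sup>*) N"
  proof (intro equalityI subsetI)
    fix B assume "B \<in> (\<lambda>C. C - M) ` A2"
    then obtain C v where C: "B = C - M" "C \<in> A" "v \<in> C" "v \<in> N" by (auto simp: A2_def)
    then have "C = (R \<union> S)\<^sup>* `` {v}" "C \<subseteq> M \<union> N"
      using closed_comps_memD[OF sym] unfolding A_def by blast+
    moreover have "v \<notin> M" using C MN by auto
    ultimately have "B = R'\<^sup>* `` {v}" "B \<subseteq> N" using outer C by auto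
    then show "B \<in> closed_comps (R'\<^sup>*) N"
      using C by (auto simp: closed_comps_def)
  next
    fix B assume "B \<in> closed_comps (R'\<^sup>*) N"
    then obtain v where v: "v \<in> N" "B = R'\<^sup>* `` {v}" "B \<subseteq> N" by (auto simp: closed_comps_def)
    define C where "C = (R \<union> S)\<^sup>* `` {v}"
    have "v \<notin> M" using v MN by auto
    then have B: "B = C - M" using v outer by (simp add: C_def)
    then have "C \<subseteq> M \<union> N" using v by auto
    moreover have "v \<in> C" by (simp add: C_def)
    ultimately have "C \<in> A2"
      using v unfolding A2_def A_def closed_comps_def C_def by blast
    with B show "B \<in> (\<lambda>C. C - M) ` A2" by blast
  qed
  moreover have "inj_on (\<lambda>C. C - M) A2"
  proof (rule inj_onI)
    fix C C' assume C: "C \<in> A2" "C' \<in> A2" and eq: "C - M = C' - M"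
    then obtain v where v: "v \<in> C" "v \<in> N" by (auto simp: A2_def)
    then have "v \<in> C'" using eq MN by auto
    with v C show "C = C'"
      using closed_comps_memD(1)[OF sym] unfolding A2_def A_def by blast
  qed
  ultimately have "card A2 = card (closed_comps (R'\<^sup>*) N)" by (metis card_image)
  with card_A A1 show ?thesis
    by (simp add: A_def R'_def)
qed

section \<open>Diagrams as equivalence relations\<close>

definition rel :: "int set set \<Rightarrow> (int \<times> int) set" where
  "rel d = {(x, y). \<exists>B\<in>d. x \<in> B \<and> y \<in> B}"

lemma equiv_rel: "d \<in> diagrams n \<Longrightarrow> equiv (nodes n) (rel d)"
  unfolding diagrams_def rel_def using equiv_partition_on by blast

lemma rel_sym: "(x, y) \<in> rel d \<Longrightarrow> (y, x) \<in> rel d"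
  by (auto simp: rel_def)

lemma rel_nodes: "d \<in> diagrams n \<Longrightarrow> (x, y) \<in> rel d \<Longrightarrow> x \<in> nodes n \<and> y \<in> nodes n"
  using equiv_rel[of d n] by (auto simp: equiv_def refl_on_def)

lemma rel_refl: "d \<in> diagrams n \<Longrightarrow> x \<in> nodes n \<Longrightarrow> (x, x) \<in> rel d"
  using equiv_rel[of d n] by (simp add: equiv_def refl_on_def)

lemma rel_trans: "d \<in> diagrams n \<Longrightarrow> (x, y) \<in> rel d \<Longrightarrow> (y, z) \<in> rel d \<Longrightarrow> (x, z) \<in> rel d"
  using equiv_rel[of d n] by (auto simp: equiv_def dest: transD)

lemma quotient_rel: "d \<in> diagrams n \<Longrightarrow> nodes n // rel d = d"
  unfolding diagrams_def rel_def using partition_on_eq_quotient by blast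

lemma diagram_eqI: "d \<in> diagrams n \<Longrightarrow> d' \<in> diagrams n \<Longrightarrow> rel d = rel d' \<Longrightarrow> d = d'"
  using quotient_rel by metis

lemma quotient_diagram: "equiv (nodes n) r \<Longrightarrow> nodes n // r \<in> diagrams n"
  by (simp add: diagrams_def partition_on_quotient)

lemma rel_quotient: "equiv (nodes n) r \<Longrightarrow> rel (nodes n // r) = r"
  unfolding rel_def quotient_def
  by (auto simp: equiv_def refl_on_def dest: symD transD)

lemma singleton_block_iff:
  assumes "d \<in> diagrams n"
  shows "{x} \<in> d \<longleftrightarrow> x \<in> nodes n \<and> (\<forall>y. (x, y) \<in> rel d \<longrightarrow> y = x)"
proof
  assume "{x} \<in> d"
  then have "(x, x) \<in> rel d" by (auto simp: rel_def)
  moreover have "{x} = rel d `` {x}"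
    using \<open>{x} \<in> d\<close> quotient_rel[OF assms] equiv_rel[OF assms]
    by (metis equiv_class_eq_iff insertI1 in_quotient_imp_closed quotientE Image_singleton_iff
        equiv_class_self)
  ultimately show "x \<in> nodes n \<and> (\<forall>y. (x, y) \<in> rel d \<longrightarrow> y = x)"
    using rel_nodes[OF assms] by auto
next
  assume "x \<in> nodes n \<and> (\<forall>y. (x, y) \<in> rel d \<longrightarrow> y = x)"
  moreover from this have "rel d `` {x} = {x}" using rel_refl[OF assms] by auto
  ultimately show "{x} \<in> d"
    using quotientI[of x "nodes n" "rel d"] quotient_rel[OF assms] by simp
qed

lemma finite_nodes: "finite (nodes n)"
  by (simp add: nodes_def)

lemma finite_diagrams: "finite (diagrams n)"
  unfolding diagrams_def by (rule finitely_many_partition_on[OF finite_nodes])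

lemma in_nodes_iff: "x \<in> nodes n \<longleftrightarrow> x \<noteq> 0 \<and> \<bar>x\<bar> \<le> int n"
  by (auto simp: nodes_def)

section \<open>The product of diagrams\<close>

declare One_nat_def [simp del]

text \<open>As in \<open>tag1\<close> and \<open>tag2\<close>, left nodes keep their negative label only at level
  \<open>0\<close>.\<close>

definition lv :: "nat \<Rightarrow> nat \<Rightarrow> int \<Rightarrow> nat \<times> int" where
  "lv i j x = (if x < 0 then (i, if i = 0 then x else - x) else (j, x))"

text \<open>The placement \<open>t\<close> is a parameter so that the same graph serves at any pair
  of levels, in stacks of two or three diagrams.\<close>

definition edges :: "(int \<Rightarrow> 'v) \<Rightarrow> int set set \<Rightarrow> ('v \<times> 'v) set" where
  "edges t d = map_prod t t ` rel d"

definition mid :: "nat \<Rightarrow> nat \<Rightarrow> (nat \<times> int) set" where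
  "mid l n = {l} \<times> {1..int n}"

lemma finite_mid: "finite (mid l n)"
  by (simp add: mid_def)

lemma tag1_lv: "tag1 = lv 0 1"
  by (auto simp: tag1_def lv_def)

lemma tag2_lv: "tag2 = lv 1 2"
  by (auto simp: tag2_def lv_def)

lemma edges_iff: "(u, v) \<in> edges t d \<longleftrightarrow> (\<exists>x y. u = t x \<and> v = t y \<and> (x, y) \<in> rel d)"
  by (force simp: edges_def)

lemma Field_edges: "d \<in> diagrams n \<Longrightarrow> Field (edges t d) \<subseteq> t ` nodes n"
  by (force simp: Field_def edges_iff dest: rel_nodes)

lemma sym_edges: "sym (edges t d)"
  by (auto simp: edges_iff sym_def dest: rel_sym)

section \<open>Connectivity in a stack of two diagrams\<close>

lemma conn_edges: "conn a b = (edges (lv 0 1) a \<union> edges (lv 1 2) b)\<^sup>*"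
proof -
  have "(\<Union>B\<in>image t ` d. B \<times> B) = edges t d" for t :: "int \<Rightarrow> nat \<times> int" and d
    unfolding rel_def edges_def by force
  then show ?thesis by (simp add: conn_def UN_Un tag1_lv tag2_lv)
qed

lemma sym_conn: "sym (conn a b)"
  unfolding conn_edges by (intro sym_rtrancl sym_Un sym_edges)

lemma conn_sym: "(u, v) \<in> conn a b \<Longrightarrow> (v, u) \<in> conn a b"
  by (rule symD[OF sym_conn])

lemma conn_trans: "(u, v) \<in> conn a b \<Longrightarrow> (v, w) \<in> conn a b \<Longrightarrow> (u, w) \<in> conn a b"
  unfolding conn_edges by (rule rtrancl_trans)

lemma conn_refl: "(u, u) \<in> conn a b"
  by (simp add: conn_edges)

lemma conn_left: "(x, y) \<in> rel a \<Longrightarrow> (lv 0 1 x, lv 0 1 y) \<in> conn a b"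
  unfolding conn_edges by (rule r_into_rtrancl) (auto simp: edges_iff)

lemma conn_right: "(x, y) \<in> rel b \<Longrightarrow> (lv 1 2 x, lv 1 2 y) \<in> conn a b"
  unfolding conn_edges by (rule r_into_rtrancl) (auto simp: edges_iff)

lemma conn_induct [consumes 1, case_names base left right]:
  assumes "(u, v) \<in> conn a b" "P u"
    and "\<And>x y. (x, y) \<in> rel a \<Longrightarrow> P (lv 0 1 x) \<Longrightarrow> P (lv 0 1 y)"
    and "\<And>x y. (x, y) \<in> rel b \<Longrightarrow> P (lv 1 2 x) \<Longrightarrow> P (lv 1 2 y)"
  shows "P v"
  using assms(1) unfolding conn_edges
  by (induction rule: rtrancl_induct) (use assms(2-4) in \<open>auto simp: edges_iff\<close>)

text \<open>Gives upper bounds on connectivity. With \<open>Q\<close> the relation of the left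
  factor together with \<open>Id\<close>, a suitable \<open>r\<close> shows that stacking a second
  diagram creates no further connections.\<close>

lemma conn_retract:
  assumes "(u, v) \<in> conn a b" "refl Q" "trans Q"
    and "\<And>x y. (x, y) \<in> rel a \<Longrightarrow> (r (lv 0 1 x), r (lv 0 1 y)) \<in> Q"
    and "\<And>x y. (x, y) \<in> rel b \<Longrightarrow> (r (lv 1 2 x), r (lv 1 2 y)) \<in> Q"
  shows "(r u, r v) \<in> Q"
  using assms(1)
  by (induction rule: conn_induct) (use assms in \<open>blast dest: reflD transD\<close>)+

lemma stack_vertices_iff:
  "(l, x) \<in> stack_vertices n \<longleftrightarrow>
    (l = 0 \<and> - int n \<le> x \<and> x < 0) \<or> ((l = 1 \<or> l = 2) \<and> 0 < x \<and> x \<le> int n)"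
proof -
  have "(0, y) \<in> lv 0 1 ` nodes n" if "- int n \<le> y" "y < 0" for y
    using that by (intro image_eqI[of _ _ y]) (auto simp: lv_def in_nodes_iff)
  moreover have "(1, y) \<in> lv 0 1 ` nodes n" "(2, y) \<in> lv 1 2 ` nodes n" if "y \<le> int n" "y > 0" for y
    using that by (auto simp: lv_def in_nodes_iff intro!: image_eqI[of _ _ y])
  ultimately show ?thesis
    unfolding stack_vertices_def tag1_lv tag2_lv
    by (auto simp: lv_def in_nodes_iff split: if_splits)
qed

lemma conn_vertices:
  assumes "a \<in> diagrams n" "b \<in> diagrams n" "(u, v) \<in> conn a b" "u \<in> stack_vertices n"
  shows "v \<in> stack_vertices n"
  using assms(3,4)
  by (induction rule: conn_induct)
     (use rel_nodes[OF assms(1)] rel_nodes[OF assms(2)] in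
       \<open>auto simp: stack_vertices_def tag1_lv tag2_lv\<close>)

text \<open>The outer vertices are exactly the \<open>lv 0 2 x\<close> for nodes \<open>x\<close>,
  so the outer traces of components are the classes of connectivity pulled back to the nodes. Later
  arguments use this relation in place of \<open>dcomp\<close>.\<close>

lemma
  assumes a: "a \<in> diagrams n" and b: "b \<in> diagrams n"
  shows dcomp_diagram: "dcomp n a b \<in> diagrams n"
    and rel_dcomp: "rel (dcomp n a b) =
      {(x, y). x \<in> nodes n \<and> y \<in> nodes n \<and> (lv 0 2 x, lv 0 2 y) \<in> conn a b}"
proof -
  define Q where "Q = {(x, y). x \<in> nodes n \<and> y \<in> nodes n \<and> (lv 0 2 x, lv 0 2 y) \<in> conn a b}"
  have Q: "equiv (nodes n) Q"
    by (rule equivI)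
       (auto simp: Q_def refl_on_def sym_def trans_def intro: conn_refl conn_sym conn_trans)
  \<comment> \<open>Outer labels are negative on level 0 and positive on level 2, so forgetting the
    level with \<open>snd\<close> loses nothing.\<close>
  have lv_stack: "lv 0 2 x \<in> stack_vertices n" "fst (lv 0 2 x) \<noteq> 1" "snd (lv 0 2 x) = x"
    if "x \<in> nodes n" for x
    using that by (auto simp: lv_def stack_vertices_iff in_nodes_iff)
  have stack_lv: "v = lv 0 2 (snd v)" "snd v \<in> nodes n"
    if "v \<in> stack_vertices n" "fst v \<noteq> 1" for v
    using that by (cases v; auto simp: lv_def stack_vertices_iff in_nodes_iff)+
  have im: "snd ` (conn a b `` {lv 0 2 x} \<inter> {v. fst v \<noteq> 1}) = Q `` {x}" if x: "x \<in> nodes n" for x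
  proof (intro equalityI subsetI)
    fix y assume "y \<in> snd ` (conn a b `` {lv 0 2 x} \<inter> {v. fst v \<noteq> 1})"
    then obtain v where v: "y = snd v" "(lv 0 2 x, v) \<in> conn a b" "fst v \<noteq> 1" by auto
    then have "v \<in> stack_vertices n" using conn_vertices[OF a b] lv_stack x by blast
    with v stack_lv[of v] x show "y \<in> Q `` {x}" by (auto simp: Q_def)
  next
    fix y assume "y \<in> Q `` {x}"
    then show "y \<in> snd ` (conn a b `` {lv 0 2 x} \<inter> {v. fst v \<noteq> 1})"
      using lv_stack[of y] by (intro image_eqI[of _ _ "lv 0 2 y"]) (auto simp: Q_def)
  qed
  have "dcomp n a b = nodes n // Q"
  proof (intro equalityI subsetI)
    fix B assume "B \<in> dcomp n a b"
    then obtain C where C0: "B = snd ` (C \<inter> {v. fst v \<noteq> 1})" "C \<in> stack_vertices n // conn a b"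
      "C \<inter> {v. fst v \<noteq> 1} \<noteq> {}"
      unfolding dcomp_def components_def by blast
    from C0(2) obtain u where u: "C = conn a b `` {u}" "u \<in> stack_vertices n"
      by (rule quotientE)
    from C0(3) obtain v where "v \<in> C" "fst v \<noteq> 1" by blast
    note C = C0(1) u this
    then have v: "v \<in> stack_vertices n" using conn_vertices[OF a b] by auto
    have "C = conn a b `` {v}"
      using C conn_sym conn_trans by blast
    also have "v = lv 0 2 (snd v)" using stack_lv v C by blast
    finally have Cv: "C = conn a b `` {lv 0 2 (snd v)}" .
    have "snd v \<in> nodes n" using stack_lv(2) v C by blast
    then show "B \<in> nodes n // Q" using im Cv C by (simp add: quotientI)
  next
    fix B assume "B \<in> nodes n // Q"
    then obtain x where x: "x \<in> nodes n" "B = Q `` {x}" by (auto elim: quotientE)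
    let ?C = "conn a b `` {lv 0 2 x}"
    have "?C \<in> components n a b"
      unfolding components_def using lv_stack x by (auto intro: quotientI)
    moreover have "lv 0 2 x \<in> ?C \<inter> {v. fst v \<noteq> 1}"
      using lv_stack x conn_refl by auto
    ultimately show "B \<in> dcomp n a b"
      unfolding dcomp_def using im x by blast
  qed
  then show "dcomp n a b \<in> diagrams n" "rel (dcomp n a b) = Q"
    using quotient_diagram[OF Q] rel_quotient[OF Q] by simp_all
qed

lemma nloops_closed_comps:
  assumes "a \<in> diagrams n" "b \<in> diagrams n"
  shows "nloops n a b = card (closed_comps (conn a b) (mid 1 n))"
proof -
  have mid: "v \<in> mid 1 n \<longleftrightarrow> v \<in> stack_vertices n \<and> fst v = 1" for v
    by (cases v) (auto simp: mid_def stack_vertices_iff)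
  have "{C \<in> components n a b. \<forall>v\<in>C. fst v = 1} = closed_comps (conn a b) (mid 1 n)"
  proof (intro equalityI subsetI)
    fix C assume "C \<in> {C \<in> components n a b. \<forall>v\<in>C. fst v = 1}"
    then obtain u where u: "u \<in> stack_vertices n" "C = conn a b `` {u}" "\<forall>v\<in>C. fst v = 1"
      by (auto simp: components_def quotient_def)
    have "C \<subseteq> mid 1 n"
    proof
      fix v assume "v \<in> C"
      then show "v \<in> mid 1 n" using u conn_vertices[OF assms, of u v] unfolding mid by blast
    qed
    moreover from this have "u \<in> mid 1 n" using u conn_refl by blast
    ultimately show "C \<in> closed_comps (conn a b) (mid 1 n)"
      using u unfolding closed_comps_def by blast
  next
    fix C assume "C \<in> closed_comps (conn a b) (mid 1 n)"
    then show "C \<in> {C \<in> components n a b. \<forall>v\<in>C. fst v = 1}"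
      using mid by (auto simp: closed_comps_def components_def intro!: quotientI)
  qed
  then show ?thesis by (simp add: nloops_def)
qed

text \<open>Moves a stack of two diagrams to the levels \<open>i\<close>, \<open>j\<close>, \<open>k\<close>
  inside a stack of three diagrams, which has the levels \<open>0\<close> to \<open>3\<close>.\<close>

definition relabels :: "(nat \<times> int \<Rightarrow> nat \<times> int) \<Rightarrow> nat \<Rightarrow> nat \<Rightarrow> nat \<Rightarrow> bool" where
  "relabels f i j k \<longleftrightarrow> inj f \<and> (\<forall>x. f (lv 0 1 x) = lv i j x) \<and> (\<forall>x. f (lv 1 2 x) = lv j k x)
     \<and> (\<forall>x. f (lv 0 2 x) = lv i k x)"

section \<open>Stacks of three diagrams and associativity\<close>

lemma relabels_edges:
  assumes "relabels f i j k"
  shows "map_prod f f ` (edges (lv 0 1) a \<union> edges (lv 1 2) b) = edges (lv i j) a \<union> edges (lv j k) b"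
proof -
  have "(\<lambda>x. f (lv 0 1 x)) = lv i j" "(\<lambda>x. f (lv 1 2 x)) = lv j k"
    using assms by (auto simp: relabels_def)
  then show ?thesis
    by (simp add: edges_def image_Un image_image map_prod.comp[THEN fun_cong, unfolded o_apply])
qed

lemma relabels_conn:
  assumes f: "relabels f i j k"
  shows "(lv i k x, lv i k y) \<in> (edges (lv i j) a \<union> edges (lv j k) b)\<^sup>* \<longleftrightarrow>
    (lv 0 2 x, lv 0 2 y) \<in> conn a b"
proof -
  have inj: "inj f" and lv: "lv i k x = f (lv 0 2 x)" "lv i k y = f (lv 0 2 y)"
    using f by (simp_all add: relabels_def)
  show ?thesis
    unfolding lv relabels_edges[OF f, symmetric] conn_edges rtrancl_map_prod_inj[OF inj]
    by (simp add: inj_eq[OF inj])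
qed

lemma relabels_nloops:
  assumes f: "relabels f i j k" and "a \<in> diagrams n" "b \<in> diagrams n"
  shows "card (closed_comps ((edges (lv i j) a \<union> edges (lv j k) b)\<^sup>*) (mid j n)) = nloops n a b"
proof -
  have f1: "f (1, x) = (j, x)" if "x > 0" for x
  proof -
    have "f (lv 0 1 x) = lv i j x" using f by (simp add: relabels_def)
    then show ?thesis using that by (simp add: lv_def)
  qed
  have "mid l n = Pair l ` {1..int n}" for l by (auto simp: mid_def)
  then have "f ` mid 1 n = mid j n"
    by (simp add: image_image f1 cong: image_cong_simp)
  then show ?thesis
    using card_closed_comps_map[of f "edges (lv 0 1) a \<union> edges (lv 1 2) b" "mid 1 n"] f assms
    by (simp add: relabels_edges[OF f] nloops_closed_comps conn_edges relabels_def)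
qed

text \<open>Contracting the middle level of a stack leaves the edges of the product and trivial
  pairs from \<open>Id\<close>, which the closure absorbs. The level \<open>j\<close> must not be 0
  because \<open>mid\<close> contains only positive labels.\<close>

lemma relabels_contract:
  assumes f: "relabels f i j k" and ab: "a \<in> diagrams n" "b \<in> diagrams n"
    and ijk: "i \<noteq> j" "k \<noteq> j" "j \<noteq> 0"
  shows "(Restr ((edges (lv i j) a \<union> edges (lv j k) b)\<^sup>*) (- mid j n) \<union> S)\<^sup>* =
    (edges (lv i k) (dcomp n a b) \<union> S)\<^sup>*"
proof -
  define R where "R = edges (lv i j) a \<union> edges (lv j k) b"
  have out: "lv i k x \<notin> mid j n" for x
    using ijk by (auto simp: lv_def mid_def)
  have R: "(lv i k x, lv i k y) \<in> R\<^sup>* \<longleftrightarrow> (x, y) \<in> rel (dcomp n a b)"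
    if "x \<in> nodes n" "y \<in> nodes n" for x y
    using that unfolding R_def relabels_conn[OF f] rel_dcomp[OF ab] by simp
  have 1: "edges (lv i k) (dcomp n a b) \<subseteq> Restr (R\<^sup>*) (- mid j n)"
    using R out rel_nodes[OF dcomp_diagram[OF ab]] by (auto simp: edges_iff)
  have vertex: "\<exists>x\<in>nodes n. u = lv i k x" if "u \<in> Field R" "u \<notin> mid j n" for u
  proof -
    from that(1) obtain x where "x \<in> nodes n" "u = lv i j x \<or> u = lv j k x"
      using Field_edges[OF ab(1), of "lv i j"] Field_edges[OF ab(2), of "lv j k"]
      unfolding R_def Field_Un by blast
    with that(2) ijk show ?thesis
      by (intro bexI[of _ x]) (auto simp: lv_def mid_def in_nodes_iff split: if_splits)
  qed
  have 2: "Restr (R\<^sup>*) (- mid j n) \<subseteq> edges (lv i k) (dcomp n a b) \<union> Id"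
  proof
    fix p assume "p \<in> Restr (R\<^sup>*) (- mid j n)"
    then obtain u v where p: "p = (u, v)" "(u, v) \<in> R\<^sup>*" "u \<notin> mid j n" "v \<notin> mid j n"
      by auto
    show "p \<in> edges (lv i k) (dcomp n a b) \<union> Id"
    proof (cases "u = v")
      case False
      with p(2) have "(u, v) \<in> R\<^sup>+" by (simp add: rtrancl_eq_or_trancl)
      then have "u \<in> Field R" "v \<in> Field R"
        by (auto simp: Field_def dest: tranclD tranclD2)
      then obtain x y where "u = lv i k x" "v = lv i k y" "x \<in> nodes n" "y \<in> nodes n"
        using vertex p by blast
      with p R[of x y] show ?thesis by (auto simp: edges_iff)
    qed (use p in auto)
  qed
  have "(Restr (R\<^sup>*) (- mid j n) \<union> S)\<^sup>* = (edges (lv i k) (dcomp n a b) \<union> S)\<^sup>*"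
  proof (rule rtrancl_subset)
    show "edges (lv i k) (dcomp n a b) \<union> S \<subseteq> Restr (R\<^sup>*) (- mid j n) \<union> S" using 1 by blast
    show "Restr (R\<^sup>*) (- mid j n) \<union> S \<subseteq> (edges (lv i k) (dcomp n a b) \<union> S)\<^sup>*"
      using 2 by blast
  qed
  then show ?thesis by (simp add: R_def)
qed

text \<open>In the shift to levels 1, 2, 3 the labels of level 0 change sign, since negative labels
  occur on level 0 only.\<close>

lemma
  shows relabels_012: "relabels id 0 1 2"
    and relabels_023: "relabels (\<lambda>(l, x). (if l = 0 then 0 else l + 1, x)) 0 2 3"
    and relabels_013: "relabels (\<lambda>(l, x). (if l < 2 then l else l + 1, x)) 0 1 3"
    and relabels_123: "relabels (\<lambda>(l, x). (l + 1, if l = 0 then - x else x)) 1 2 3"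
  by (auto simp: relabels_def lv_def inj_def split: if_splits)

text \<open>Both bracketings come from the one graph \<open>K1 \<union> K2 \<union> K3\<close>:
  contracting level 1 first gives the left-hand side, contracting level 2 first the right-hand side.
  Either way the loops add up to the components of this graph lying in the two middle
  levels.\<close>

lemma
  assumes a: "a \<in> diagrams n" and b: "b \<in> diagrams n" and c: "c \<in> diagrams n"
  shows dcomp_assoc: "dcomp n (dcomp n a b) c = dcomp n a (dcomp n b c)"
    and nloops_cocycle:
      "nloops n a b + nloops n (dcomp n a b) c = nloops n b c + nloops n a (dcomp n b c)"
proof -
  define K1 K2 K3 where "K1 = edges (lv 0 1) a" and "K2 = edges (lv 1 2) b"
    and "K3 = edges (lv 2 3) c"
  note ab = dcomp_diagram[OF a b] and bc = dcomp_diagram[OF b c]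
  have F3: "Field K3 \<inter> mid 1 n = {}" and F1: "Field K1 \<inter> mid 2 n = {}"
    by (auto simp: K1_def K3_def Field_def edges_iff lv_def mid_def split: if_splits)
  have symK: "sym K1" "sym K2" "sym K3"
    by (simp_all add: K1_def K2_def K3_def sym_edges)
  have K: "(K2 \<union> K3) \<union> K1 = (K1 \<union> K2) \<union> K3" by auto
  have left: "(Restr ((K1 \<union> K2)\<^sup>*) (- mid 1 n) \<union> K3)\<^sup>* = (edges (lv 0 2) (dcomp n a b) \<union> K3)\<^sup>*"
    unfolding K1_def K2_def by (rule relabels_contract[OF relabels_012 a b]) auto
  have right: "(Restr ((K2 \<union> K3)\<^sup>*) (- mid 2 n) \<union> K1)\<^sup>* = (K1 \<union> edges (lv 1 3) (dcomp n b c))\<^sup>*"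
    unfolding K2_def K3_def
    by (subst relabels_contract[OF relabels_123 b c]) (auto simp: Un_commute)
  have out: "lv 0 3 x \<notin> mid 1 n" "lv 0 3 x \<notin> mid 2 n" for x
    by (auto simp: lv_def mid_def)
  have "(lv 0 2 x, lv 0 2 y) \<in> conn (dcomp n a b) c \<longleftrightarrow> (lv 0 2 x, lv 0 2 y) \<in> conn a (dcomp n b c)"
    for x y
  proof -
    have "(lv 0 2 x, lv 0 2 y) \<in> conn (dcomp n a b) c \<longleftrightarrow>
        (lv 0 3 x, lv 0 3 y) \<in> ((K1 \<union> K2) \<union> K3)\<^sup>*"
      unfolding rtrancl_contract_outer[OF F3 out(1) out(1), where R = "K1 \<union> K2"] left
      unfolding K3_def relabels_conn[OF relabels_023] ..
    also have "\<dots> \<longleftrightarrow> (lv 0 2 x, lv 0 2 y) \<in> conn a (dcomp n b c)"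
      unfolding K[symmetric] rtrancl_contract_outer[OF F1 out(2) out(2), where R = "K2 \<union> K3"] right
      unfolding K1_def relabels_conn[OF relabels_013] ..
    finally show ?thesis .
  qed
  then have "rel (dcomp n (dcomp n a b) c) = rel (dcomp n a (dcomp n b c))"
    by (simp add: rel_dcomp a b c ab bc)
  then show "dcomp n (dcomp n a b) c = dcomp n a (dcomp n b c)"
    by (rule diagram_eqI[OF dcomp_diagram[OF ab c] dcomp_diagram[OF a bc]])
  have disj: "mid 1 n \<inter> mid 2 n = {}" by (auto simp: mid_def)
  have "nloops n a b + nloops n (dcomp n a b) c =
      card (closed_comps (((K1 \<union> K2) \<union> K3)\<^sup>*) (mid 1 n \<union> mid 2 n))"
    using card_closed_comps_contract[OF sym_Un[OF symK(1,2)] symK(3) F3 disj finite_mid finite_mid]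
      relabels_nloops[OF relabels_012 a b] relabels_nloops[OF relabels_023 ab c]
    unfolding left by (simp add: K1_def K2_def K3_def)
  also have "\<dots> = nloops n b c + nloops n a (dcomp n b c)"
    using card_closed_comps_contract[OF sym_Un[OF symK(2,3)] symK(1) F1 _ finite_mid finite_mid,
        of 1] disj
      relabels_nloops[OF relabels_123 b c] relabels_nloops[OF relabels_013 a bc]
    unfolding right K by (simp add: K1_def K2_def K3_def Int_commute Un_commute)
  finally show "nloops n a b + nloops n (dcomp n a b) c = nloops n b c + nloops n a (dcomp n b c)" .
qed

section \<open>Permutation diagrams\<close>

lemma perm_diagram_rel:
  assumes "d \<in> diagrams n" "perm_diagram d" "(x, y) \<in> rel d" "x > 0"
  shows "y = x \<or> y < 0" and "(x, z) \<in> rel d \<Longrightarrow> y < 0 \<Longrightarrow> z < 0 \<Longrightarrow> y = z"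
proof -
  have *: "\<exists>i j. i > 0 \<and> j > 0 \<and> u \<in> {- i, j} \<and> v \<in> {- i, j} \<and> rel d `` {u} = {- i, j}"
    if "(u, v) \<in> rel d" for u v :: int
  proof -
    from that obtain B where B: "B \<in> d" "u \<in> B" "v \<in> B" by (auto simp: rel_def)
    have "rel d `` {u} = B"
    proof -
      have "B \<in> nodes n // rel d" using B quotient_rel[OF assms(1)] by simp
      then obtain w where "B = rel d `` {w}" by (rule quotientE)
      then show ?thesis using B equiv_class_eq[OF equiv_rel[OF assms(1)]] by fastforce
    qed
    moreover obtain i j where "i > 0" "j > 0" "B = {- i, j}"
      using assms(2) B unfolding perm_diagram_def by blast
    ultimately show ?thesis using B by auto
  qed
  from *[OF assms(3)] obtain i j where ij: "i > 0" "j > 0" "x \<in> {- i, j}" "y \<in> {- i, j}"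
    "rel d `` {x} = {- i, j}" by blast
  show "y = x \<or> y < 0" using ij assms(4) by auto
  assume "(x, z) \<in> rel d" "y < 0" "z < 0"
  then have "z \<in> rel d `` {x}" by simp
  then have "z \<in> {- i, j}" by (simp only: ij(5))
  then show "y = z" using ij \<open>y < 0\<close> \<open>z < 0\<close> by auto
qed

text \<open>Conditions on right nodes suffice by counting: \<open>n\<close> right nodes in distinct
  blocks, each with a left partner, use up all \<open>n\<close> left nodes.\<close>

lemma perm_diagram_iff:
  assumes d: "d \<in> diagrams n"
  shows "perm_diagram d \<longleftrightarrow>
    (\<forall>x\<in>{1..int n}. (\<exists>y<0. (x, y) \<in> rel d) \<and> (\<forall>y>0. (x, y) \<in> rel d \<longrightarrow> y = x))"
proof
  assume p: "perm_diagram d"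
  show "\<forall>x\<in>{1..int n}. (\<exists>y<0. (x, y) \<in> rel d) \<and> (\<forall>y>0. (x, y) \<in> rel d \<longrightarrow> y = x)"
  proof (intro ballI conjI allI impI)
    fix x assume x: "x \<in> {1..int n}"
    then have "x \<in> nodes n" by (simp add: in_nodes_iff)
    then obtain B where B: "B \<in> d" "x \<in> B" using rel_refl[OF d] by (auto simp: rel_def)
    then obtain i j where "i > 0" "B = {- i, j}" using p unfolding perm_diagram_def by blast
    then show "\<exists>y<0. (x, y) \<in> rel d"
      using B by (intro exI[of _ "- i"]) (auto simp: rel_def)
    fix y assume "y > 0" "(x, y) \<in> rel d"
    then show "y = x" using perm_diagram_rel(1)[OF d p, of x y] x by auto
  qed
next
  assume R: "\<forall>x\<in>{1..int n}. (\<exists>y<0. (x, y) \<in> rel d) \<and> (\<forall>y>0. (x, y) \<in> rel d \<longrightarrow> y = x)"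
  then obtain p where p: "\<And>x. x \<in> {1..int n} \<Longrightarrow> p x < 0 \<and> (x, p x) \<in> rel d"
    by metis
  have inj: "inj_on p {1..int n}"
  proof (rule inj_onI)
    fix x y assume xy: "x \<in> {1..int n}" "y \<in> {1..int n}" "p x = p y"
    then have "(x, y) \<in> rel d" using p rel_sym rel_trans[OF d] by metis
    then have "y = x" using bspec[OF R xy(1)] xy(2) by auto
    then show "x = y" ..
  qed
  have "p ` {1..int n} \<subseteq> {- int n..-1}"
  proof
    fix y assume "y \<in> p ` {1..int n}"
    then obtain x where "x \<in> {1..int n}" "y = p x" by blast
    then show "y \<in> {- int n..-1}" using p[of x] rel_nodes[OF d, of x y] by (auto simp: in_nodes_iff)
  qed
  \<comment> \<open>An injection between two sets of size \<open>n\<close> is onto, so every left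
    node is the chosen partner of a right node.\<close>
  then have surj: "p ` {1..int n} = {- int n..-1}"
    by (rule card_subset_eq[rotated]) (simp_all add: card_image[OF inj])
  show "perm_diagram d"
    unfolding perm_diagram_def
  proof
    fix B assume B: "B \<in> d"
    have mem: "z \<in> B" if "y \<in> B" "(y, z) \<in> rel d" for y z
    proof -
      have "B \<in> nodes n // rel d" using B quotient_rel[OF d] by simp
      then show ?thesis using in_quotient_imp_closed[OF equiv_rel[OF d]] that by blast
    qed
    have "B \<noteq> {}" "B \<subseteq> nodes n"
      using B d partition_onD1[of "nodes n" d] partition_onD3[of "nodes n" d] by (auto simp: diagrams_def)
    then obtain y where y: "y \<in> B" "y \<in> nodes n" by auto
    have "\<exists>x\<in>{1..int n}. x \<in> B"
    proof (cases "y > 0")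
      case True
      then show ?thesis using y by (auto simp: in_nodes_iff)
    next
      case False
      then have "y \<in> p ` {1..int n}" using y surj by (auto simp: in_nodes_iff)
      then obtain x where "x \<in> {1..int n}" "y = p x" by blast
      then show ?thesis using mem[OF y(1), of x] p rel_sym by blast
    qed
    then obtain x where x: "x \<in> {1..int n}" "x \<in> B" by blast
    have "B = {p x, x}"
    proof (intro equalityI subsetI)
      fix z assume z: "z \<in> B"
      then have xz: "(x, z) \<in> rel d" using B x by (auto simp: rel_def)
      show "z \<in> {p x, x}"
      proof (cases "z > 0")
        case True
        then show ?thesis using R x xz by auto
      next
        case False
        have "z \<in> nodes n" using xz rel_nodes[OF d] by blast
        with False have "z \<in> p ` {1..int n}" unfolding surj by (auto simp: in_nodes_iff)
        then obtain x' where x': "x' \<in> {1..int n}" "z = p x'" by blast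
        then have "(x, x') \<in> rel d" using p[of x'] xz rel_sym rel_trans[OF d] by blast
        then have "x' = x" using R x x' by auto
        with x' show ?thesis by simp
      qed
    next
      fix z assume "z \<in> {p x, x}"
      then show "z \<in> B" using x p mem by blast
    qed
    then show "\<exists>i j. i > 0 \<and> j > 0 \<and> B = {- i, j}"
      using p x by (intro exI[of _ "- p x"] exI[of _ x]) auto
  qed
qed

section \<open>Products and permutation diagrams\<close>

text \<open>A block of \<open>b\<close> consisting of right nodes only has no contact with the
  middle level, so in the stack it remains a component by itself.\<close>

lemma conn_right_block:
  assumes "\<And>y. (x, y) \<in> rel b \<Longrightarrow> y > 0" "b \<in> diagrams n" "x \<in> nodes n"
    and "(lv 1 2 x, v) \<in> conn a b"
  shows "\<exists>y. (x, y) \<in> rel b \<and> v = (2, y)"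
  using assms(4)
proof (induction rule: conn_induct)
  case base
  have "(x, x) \<in> rel b" using rel_refl assms by blast
  then show ?case using assms(1)[of x] by (auto simp: lv_def)
next
  case (left y z)
  then show ?case by (auto simp: lv_def split: if_splits)
next
  case (right y z)
  then have "(x, y) \<in> rel b" by (auto simp: lv_def split: if_splits)
  then have "(x, z) \<in> rel b" using right rel_trans[OF assms(2)] by blast
  then show ?case using assms(1)[of z] by (auto simp: lv_def)
qed

lemma lv_pos: "x > 0 \<Longrightarrow> lv 0 2 x = lv 1 2 x"
  by (simp add: lv_def)

lemma lv_neg: "x < 0 \<Longrightarrow> lv 0 2 x = lv 0 1 x"
  by (simp add: lv_def)

lemma rel_dcomp_right:
  assumes "a \<in> diagrams n" "b \<in> diagrams n" "(x, y) \<in> rel b" "x > 0" "y > 0"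
  shows "(x, y) \<in> rel (dcomp n a b)"
  using assms conn_right[OF assms(3), of a] rel_nodes[OF assms(2,3)]
  by (simp add: rel_dcomp lv_pos)

text \<open>Both defects on the right of \<open>b\<close> survive multiplication from the left:
  joined right nodes stay joined, and a right node without left partner gains none.\<close>

lemma perm_dcomp_right:
  assumes a: "a \<in> diagrams n" and b: "b \<in> diagrams n" and p: "perm_diagram (dcomp n a b)"
  shows "perm_diagram b"
  unfolding perm_diagram_iff[OF b]
proof (intro ballI conjI allI impI)
  note ab = dcomp_diagram[OF a b]
  fix x assume x: "x \<in> {1..int n}"
  then have xn: "x \<in> nodes n" by (simp add: in_nodes_iff)
  have right: "y = x" if "y > 0" "(x, y) \<in> rel b" for y
    using rel_dcomp_right[OF a b that(2)] that p x unfolding perm_diagram_iff[OF ab] by auto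
  then show "y = x" if "y > 0" "(x, y) \<in> rel b" for y using that by blast
  show "\<exists>y<0. (x, y) \<in> rel b"
  proof (rule ccontr)
    assume "\<not> (\<exists>y<0. (x, y) \<in> rel b)"
    then have pos: "y > 0" if "(x, y) \<in> rel b" for y
      using rel_nodes[OF b that] that by (auto simp: in_nodes_iff not_less le_less)
    obtain y where y: "y < 0" "(x, y) \<in> rel (dcomp n a b)"
      using p x unfolding perm_diagram_iff[OF ab] by blast
    then have "(lv 1 2 x, lv 0 2 y) \<in> conn a b" using x by (simp add: rel_dcomp[OF a b] lv_pos)
    from conn_right_block[OF pos b xn this] y show False by (auto simp: lv_def)
  qed
qed

text \<open>Stacking a permutation \<open>b\<close> only renames the right nodes of \<open>a\<close>
  along a bijection \<open>t\<close>. No loop arises because \<open>b\<close> connects every middle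
  node to a right node.\<close>

lemma
  assumes a: "a \<in> diagrams n" and b: "b \<in> diagrams n" and p: "perm_diagram b"
  shows perm_dcomp_iff: "perm_diagram (dcomp n a b) \<longleftrightarrow> perm_diagram a"
    and nloops_perm: "nloops n a b = 0"
proof -
  have "\<forall>x\<in>{1..int n}. \<exists>y<0. (x, y) \<in> rel b"
    using p unfolding perm_diagram_iff[OF b] by blast
  then obtain l where l: "\<And>x. x \<in> {1..int n} \<Longrightarrow> l x < 0 \<and> (x, l x) \<in> rel b" by metis
  define t where "t x = - l x" for x
  have t: "t x \<in> {1..int n}" "(x, - t x) \<in> rel b" if "x \<in> {1..int n}" for x
    using l[OF that] rel_nodes[OF b, of x "l x"] by (auto simp: t_def in_nodes_iff)
  have t_eq: "t x = - y" if "x > 0" "y < 0" "(x, y) \<in> rel b" for x y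
  proof -
    have "x \<in> {1..int n}" using that rel_nodes[OF b that(3)] by (auto simp: in_nodes_iff)
    then show ?thesis
      using perm_diagram_rel(2)[OF b p that(3,1), of "l x"] l that by (auto simp: t_def)
  qed
  have inj: "inj_on t {1..int n}"
  proof (rule inj_onI)
    fix x y assume xy: "x \<in> {1..int n}" "y \<in> {1..int n}" "t x = t y"
    then have "(x, y) \<in> rel b" using t(2) rel_sym rel_trans[OF b] by metis
    then have "y = x"
      using bspec[OF p[unfolded perm_diagram_iff[OF b]] xy(1)] xy(2) by auto
    then show "x = y" ..
  qed
  have surj: "t ` {1..int n} = {1..int n}"
    by (rule endo_inj_surj[OF _ _ inj]) (use t in auto)
  have ball_t: "(\<forall>x\<in>{1..int n}. P (t x)) \<longleftrightarrow> (\<forall>x\<in>{1..int n}. P x)" for P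
    using ball_simps(9)[of t "{1..int n}" P] unfolding surj by blast
  have tv: "(lv 1 2 x, lv 0 1 (t x)) \<in> conn a b" if "x \<in> {1..int n}" for x
    using conn_right[OF t(2)[OF that], of a] t(1)[OF that] by (auto simp: lv_def)
  \<comment> \<open>The stack is collapsed onto \<open>a\<close>: a right node of \<open>b\<close>
    goes to the middle node it is attached to, which is a right node of \<open>a\<close>.\<close>
  define r where "r v = (if fst v = 2 then t (snd v) else snd v)" for v :: "nat \<times> int"
  have retract: "(r u, r v) \<in> rel a \<union> Id" if "(u, v) \<in> conn a b" for u v
    using that
  proof (rule conn_retract)
    show "refl (rel a \<union> Id)" by (auto simp: refl_on_def)
    show "trans (rel a \<union> Id)" using rel_trans[OF a] by (auto simp: trans_def)
    show "(r (lv 0 1 x), r (lv 0 1 y)) \<in> rel a \<union> Id" if "(x, y) \<in> rel a" for x y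
      using that by (auto simp: r_def lv_def)
    show "(r (lv 1 2 x), r (lv 1 2 y)) \<in> rel a \<union> Id" if xy: "(x, y) \<in> rel b" for x y
    proof -
      have nz: "x \<noteq> 0" "y \<noteq> 0" using rel_nodes[OF b xy] by (auto simp: in_nodes_iff)
      consider "x > 0" "y > 0" | "x > 0" "y < 0" | "x < 0" "y > 0" | "x < 0" "y < 0"
        using nz by linarith
      then have "r (lv 1 2 x) = r (lv 1 2 y)"
      proof cases
        case 1
        then have "y = x" using perm_diagram_rel(1)[OF b p xy] by auto
        then show ?thesis by simp
      next
        case 2
        then show ?thesis using t_eq[OF _ _ xy] by (simp add: r_def lv_def)
      next
        case 3
        then show ?thesis using t_eq[OF _ _ rel_sym[OF xy]] by (simp add: r_def lv_def)
      next
        case 4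
        obtain B where B: "B \<in> b" "x \<in> B" "y \<in> B" using xy by (auto simp: rel_def)
        then obtain i j where "i > 0" "j > 0" "B = {- i, j}"
          using p unfolding perm_diagram_def by blast
        then show ?thesis using 4 B by auto
      qed
      then show ?thesis by simp
    qed
  qed
  define \<rho> where "\<rho> x = (if x < 0 then x else t x)" for x
  have r_lv: "r (lv 0 2 x) = \<rho> x" for x by (simp add: r_def \<rho>_def lv_def)
  have \<rho>_conn: "(lv 0 2 x, lv 0 1 (\<rho> x)) \<in> conn a b" "\<rho> x \<in> nodes n" if "x \<in> nodes n" for x
    using tv[of x] t(1)[of x] that by (auto simp: \<rho>_def lv_pos lv_neg in_nodes_iff conn_refl)
  have rel_ab: "(x, y) \<in> rel (dcomp n a b) \<longleftrightarrow> (\<rho> x, \<rho> y) \<in> rel a" if "x \<in> nodes n" "y \<in> nodes n" for x y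
  proof
    assume "(x, y) \<in> rel (dcomp n a b)"
    then have "(\<rho> x, \<rho> y) \<in> rel a \<union> Id"
      using retract[of "lv 0 2 x" "lv 0 2 y"] by (simp add: r_lv rel_dcomp[OF a b])
    then show "(\<rho> x, \<rho> y) \<in> rel a" using rel_refl[OF a] \<rho>_conn(2) that by auto
  next
    assume "(\<rho> x, \<rho> y) \<in> rel a"
    then have "(lv 0 2 x, lv 0 2 y) \<in> conn a b"
      using conn_left \<rho>_conn(1) that conn_sym conn_trans by meson
    then show "(x, y) \<in> rel (dcomp n a b)" using that by (simp add: rel_dcomp[OF a b])
  qed
  have "(\<exists>y<0. (x, y) \<in> rel (dcomp n a b)) \<longleftrightarrow> (\<exists>y<0. (t x, y) \<in> rel a)"
    if x: "x \<in> {1..int n}" for x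
  proof -
    have "x \<in> nodes n" "\<rho> x = t x" using x by (auto simp: in_nodes_iff \<rho>_def)
    moreover have "\<rho> y = y" if "y < 0" for y using that by (simp add: \<rho>_def)
    ultimately show ?thesis
      using rel_ab rel_nodes[OF a] rel_nodes[OF dcomp_diagram[OF a b]] by metis
  qed
  moreover have "(\<forall>y>0. (x, y) \<in> rel (dcomp n a b) \<longrightarrow> y = x) \<longleftrightarrow> (\<forall>y>0. (t x, y) \<in> rel a \<longrightarrow> y = t x)"
    if x: "x \<in> {1..int n}" for x
  proof -
    have pos: "y > 0 \<and> (x, y) \<in> rel (dcomp n a b) \<longleftrightarrow> y \<in> {1..int n} \<and> (t x, t y) \<in> rel a" for y
    proof (cases "y \<in> {1..int n}")
      case True
      then have "(x, y) \<in> rel (dcomp n a b) \<longleftrightarrow> (\<rho> x, \<rho> y) \<in> rel a"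
        using x by (intro rel_ab) (auto simp: in_nodes_iff)
      with True x show ?thesis by (simp add: \<rho>_def)
    next
      case False
      then show ?thesis using rel_nodes[OF dcomp_diagram[OF a b], of x y] by (auto simp: in_nodes_iff)
    qed
    have "(\<forall>y>0. (t x, y) \<in> rel a \<longrightarrow> y = t x) \<longleftrightarrow> (\<forall>y\<in>{1..int n}. (t x, y) \<in> rel a \<longrightarrow> y = t x)"
    proof -
      have "y > 0 \<and> (t x, y) \<in> rel a \<longleftrightarrow> y \<in> {1..int n} \<and> (t x, y) \<in> rel a" for y
        using rel_nodes[OF a, of "t x" y] by (auto simp: in_nodes_iff)
      then show ?thesis by blast
    qed
    also have "\<dots> \<longleftrightarrow> (\<forall>y\<in>{1..int n}. (t x, t y) \<in> rel a \<longrightarrow> t y = t x)"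
      by (rule ball_t[symmetric])
    also have "\<dots> \<longleftrightarrow> (\<forall>y\<in>{1..int n}. (t x, t y) \<in> rel a \<longrightarrow> y = x)"
      using inj x by (auto simp: inj_on_def)
    finally show ?thesis using pos by blast
  qed
  ultimately have "perm_diagram (dcomp n a b) \<longleftrightarrow>
     (\<forall>x\<in>{1..int n}. (\<exists>y<0. (t x, y) \<in> rel a) \<and> (\<forall>y>0. (t x, y) \<in> rel a \<longrightarrow> y = t x))"
    unfolding perm_diagram_iff[OF dcomp_diagram[OF a b]] by blast
  also have "\<dots> \<longleftrightarrow> perm_diagram a"
    unfolding perm_diagram_iff[OF a] by (rule ball_t)
  finally show "perm_diagram (dcomp n a b) \<longleftrightarrow> perm_diagram a" .
  have "closed_comps (conn a b) (mid 1 n) = {}"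
  proof -
    have "\<not> conn a b `` {v} \<subseteq> mid 1 n" if "v \<in> mid 1 n" for v
    proof -
      have "snd v \<in> t ` {1..int n}" using that unfolding surj by (auto simp: mid_def)
      then obtain x where x: "x \<in> {1..int n}" "snd v = t x" by blast
      then have "v = lv 0 1 (t x)" using that t(1)[of x] by (cases v) (auto simp: lv_def mid_def)
      then have "lv 1 2 x \<in> conn a b `` {v}" using tv[OF x(1)] conn_sym by auto
      moreover have "lv 1 2 x \<notin> mid 1 n" using x by (auto simp: lv_def mid_def)
      ultimately show ?thesis by blast
    qed
    then show ?thesis by (auto simp: closed_comps_def)
  qed
  then show "nloops n a b = 0" by (simp add: nloops_closed_comps[OF a b])
qed

text \<open>If \<open>b\<close> is not a permutation then neither is the product and both sides
  vanish; if it is, there are no loops.\<close>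

lemma aug_mult:
  assumes "a \<in> diagrams n" "b \<in> diagrams n"
  shows "\<delta> ^ nloops n a b * of_bool (perm_diagram (dcomp n a b)) =
    (of_bool (perm_diagram a) * of_bool (perm_diagram b) :: 'r::comm_ring_1)"
  using perm_dcomp_right[OF assms] perm_dcomp_iff[OF assms] nloops_perm[OF assms]
  by (cases "perm_diagram b") auto

section \<open>The left ideals cut out by constraints on right nodes\<close>

fun sat :: "int set set \<Rightarrow> nat \<times> nat \<Rightarrow> bool" where
  "sat d (x, y) = (if x = y then {int x} \<in> d else \<exists>B\<in>d. int x \<in> B \<and> int y \<in> B)"

lemma inJ_sat: "inJ X d \<longleftrightarrow> (\<exists>c\<in>X \<times> X. sat d c)"
proof -
  have "(\<exists>c\<in>X \<times> X. sat d c) \<longleftrightarrow> (\<exists>x\<in>X. \<exists>y\<in>X. sat d (x, y))" by blast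
  then show ?thesis unfolding inJ_def sat.simps by metis
qed

definition Lc :: "nat \<Rightarrow> nat \<times> nat \<Rightarrow> int set set set" where
  "Lc n c = {d \<in> diagrams n. sat d c}"

lemma sat_rel:
  assumes "d \<in> diagrams n" "x \<in> {1..n}"
  shows "sat d (x, y) \<longleftrightarrow> (if x = y then \<forall>z. (int x, z) \<in> rel d \<longrightarrow> z = int x
     else (int x, int y) \<in> rel d)"
  using assms by (auto simp: singleton_block_iff in_nodes_iff rel_def)

text \<open>This is why a constraint cuts out a left ideal: left multiplication neither separates
  right nodes of \<open>b\<close> nor reaches an isolated one.\<close>

lemma sat_dcomp:
  assumes a: "a \<in> diagrams n" and b: "b \<in> diagrams n" and xy: "x \<in> {1..n}" "y \<in> {1..n}"
    and sat: "sat b (x, y)"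
  shows "sat (dcomp n a b) (x, y)"
proof (cases "x = y")
  case True
  have iso: "z = int x" if "(int x, z) \<in> rel b" for z
    using sat that True sat_rel[OF b xy(1), of y] by simp
  have "z = int x" if z: "(int x, z) \<in> rel (dcomp n a b)" for z
  proof -
    have "(lv 1 2 (int x), lv 0 2 z) \<in> conn a b" "int x \<in> nodes n"
      using z xy by (auto simp: rel_dcomp[OF a b] lv_pos)
    then obtain w where "(int x, w) \<in> rel b" "lv 0 2 z = (2, w)"
      using conn_right_block[of "int x" b n "lv 0 2 z" a] iso b xy by fastforce
    then show ?thesis using iso[of w] by (auto simp: lv_def split: if_splits)
  qed
  then show ?thesis using True sat_rel[OF dcomp_diagram[OF a b] xy(1), of y] by simp
next
  case False
  then show ?thesis
    using sat xy rel_dcomp_right[OF a b, of "int x" "int y"]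
    by (simp add: sat_rel[OF b xy(1)] sat_rel[OF dcomp_diagram[OF a b] xy(1)] del: sat.simps)
qed

lemma sat_not_perm:
  assumes d: "d \<in> diagrams n" and xy: "x \<in> {1..n}" "y \<in> {1..n}" and sat: "sat d (x, y)"
  shows "\<not> perm_diagram d"
proof
  assume "perm_diagram d"
  then have R: "\<exists>z<0. (int x, z) \<in> rel d" "\<And>z. z > 0 \<Longrightarrow> (int x, z) \<in> rel d \<Longrightarrow> z = int x"
    using xy unfolding perm_diagram_iff[OF d] by auto
  show False
  proof (cases "x = y")
    case True
    then show ?thesis using R(1) sat sat_rel[OF d xy(1), of y] by auto
  next
    case False
    then show ?thesis using R(2)[of "int y"] sat sat_rel[OF d xy(1), of y] xy by auto
  qed
qed

text \<open>The diagram \<open>e\<close> joins each right node to its mirror image, as well as all right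
  nodes joined by every diagram in \<open>L\<close>. The isolated nodes \<open>Z\<close> are the exception:
  their mirror images all join the node \<open>w\<close> outside \<open>X\<close>, so that no loop
  arises. If there is no such node then \<open>w = 0\<close>; they form a block of their own, and
  right multiplication by \<open>e\<close> produces a single loop.\<close>

lemma idempotent_exists:
  fixes \<delta> :: "'r::comm_ring_1"
  assumes X: "X \<subseteq> {1..n}" and \<delta>: "(\<exists>u. \<delta> * u = 1) \<or> card X < n"
    and T: "T \<subseteq> X \<times> X" and ne: "diagrams n \<inter> \<Inter>(Lc n ` T) \<noteq> {}"
  shows "\<exists>e (\<kappa>::'r). e \<in> diagrams n \<inter> \<Inter>(Lc n ` T) \<and>
    (\<forall>m\<in>diagrams n \<inter> \<Inter>(Lc n ` T). dcomp n m e = m \<and> \<kappa> * \<delta> ^ nloops n m e = 1)"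
proof -
  define L where "L = diagrams n \<inter> \<Inter>(Lc n ` T)"
  define Z where "Z = {int z |z. (z, z) \<in> T}"
  have L: "m \<in> diagrams n" "\<And>c. c \<in> T \<Longrightarrow> sat m c" if "m \<in> L" for m
    using that by (auto simp: L_def Lc_def)
  obtain m0 where m0: "m0 \<in> L" using ne by (auto simp: L_def)
  have ZX: "Z \<subseteq> int ` X" "int ` X \<subseteq> {1..int n}" using T X by (auto simp: Z_def)
  have ZN: "z \<in> {1..int n}" if "z \<in> Z" for z using ZX that by blast
  have iso: "y = z" if "m \<in> L" "z \<in> Z" "(z, y) \<in> rel m \<or> (y, z) \<in> rel m" for m y z
  proof -
    from that(2) obtain x where x: "z = int x" "(x, x) \<in> T" by (auto simp: Z_def)
    then have "x \<in> {1..n}" using T X by auto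
    then show ?thesis
      using L[OF that(1)] x that(3) sat_rel[of m n x x] rel_sym[of y z m] by auto
  qed
  obtain w where w: "w = 0 \<or> w \<in> {1..int n} \<and> w \<notin> int ` X"
    and w0: "w = 0 \<Longrightarrow> \<exists>u. \<delta> * u = 1"
  proof (cases "card X < n")
    case True
    have "finite X" using finite_subset[OF X] by simp
    then have "\<not> {1..n} \<subseteq> X" using True card_mono[of X "{1..n}"] by auto
    then obtain x where "x \<in> {1..n}" "x \<notin> X" by blast
    then show ?thesis by (intro that[of "int x"]) auto
  next
    case False
    then show ?thesis using \<delta> by (intro that[of 0]) auto
  qed
  \<comment> \<open>\<open>e\<close> is obtained by pulling \<open>E\<close> back along
    \<open>q\<close>, which represents each left node by its mirror image, or by \<open>w\<close> if
    that image lies in \<open>Z\<close>. The diagonal is part of \<open>E\<close> so that the label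
    0, which is not a node, also forms a class.\<close>
  define E where "E = {(x, y). x = y \<or> x > 0 \<and> y > 0 \<and> (\<forall>m\<in>L. (x, y) \<in> rel m)}"
  define q where "q x = (if x > 0 then x else if - x \<in> Z then w else - x)" for x
  define Q where "Q = {(x, y). x \<in> nodes n \<and> y \<in> nodes n \<and> (q x, q y) \<in> E}"
  define e where "e = nodes n // Q"
  have E_trans: "(x, z) \<in> E" if "(x, y) \<in> E" "(y, z) \<in> E" for x y z
    using that rel_trans[OF L(1)] unfolding E_def by blast
  have E_sym: "(y, x) \<in> E" if "(x, y) \<in> E" for x y
    using that rel_sym by (auto simp: E_def)
  have Q: "equiv (nodes n) Q"
  proof (rule equivI)
    show "Q \<subseteq> nodes n \<times> nodes n" by (auto simp: Q_def)
    show "refl_on (nodes n) Q" by (rule refl_onI) (auto simp: Q_def E_def)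
    show "sym Q" using E_sym unfolding sym_def Q_def by blast
    show "trans Q" using E_trans unfolding trans_def Q_def by blast
  qed
  have e: "e \<in> diagrams n" and rel_e: "rel e = Q"
    using quotient_diagram[OF Q] rel_quotient[OF Q] by (simp_all add: e_def)
  have "sat e (x, y)" if xy: "(x, y) \<in> T" for x y
  proof -
    have xX: "x \<in> {1..n}" "y \<in> {1..n}" using xy T X by auto
    show ?thesis
    proof (cases "x = y")
      case True
      then have x: "int x \<in> Z" "int x \<in> int ` X" using xy ZX by (auto simp: Z_def)
      have "z = int x" if "(int x, z) \<in> Q" for z
      proof -
        have z: "z \<in> nodes n" "(int x, q z) \<in> E" using that xX by (auto simp: Q_def q_def)
        \<comment> \<open>Nonemptiness of \<open>L\<close> enters here: \<open>m0\<close> isolates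
          \<open>x\<close>, so \<open>E\<close> relates \<open>x\<close> only to itself. The mirror
          image of \<open>x\<close> is no exception, since \<open>q\<close> sends it to
          \<open>w\<close>, which differs from \<open>x\<close>.\<close>
        then have "q z = int x" using iso[OF m0 x(1), of "q z"] m0 by (auto simp: E_def)
        then show "z = int x" using x w z xX by (auto simp: q_def in_nodes_iff split: if_splits)
      qed
      then show ?thesis using True sat_rel[OF e xX(1), of y] by (simp add: rel_e del: sat.simps)
    next
      case False
      have "(int x, int y) \<in> rel m" if "m \<in> L" for m
        using L[OF that] xy sat_rel[of m n x y] xX False by auto
      then have "(int x, int y) \<in> Q" using xX by (auto simp: Q_def q_def E_def in_nodes_iff)
      then show ?thesis using False sat_rel[OF e xX(1), of y] by (simp add: rel_e del: sat.simps)
    qed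
  qed
  then have eL: "e \<in> L" using e by (auto simp: L_def Lc_def simp del: sat.simps)
  \<comment> \<open>Middle nodes in \<open>Z\<close> are isolated in \<open>m\<close>, so moving
    them to \<open>w\<close> respects the edges of \<open>m\<close>. It turns those of
    \<open>e\<close> into pairs of \<open>E\<close>, which hold in \<open>m\<close> or are trivial.
    Hence \<open>m\<close> gains no connection.\<close>
  define r where "r v = (if fst v = 1 \<and> snd v \<in> Z then w else snd v)" for v :: "nat \<times> int"
  have retract: "(r u, r v) \<in> rel m \<union> Id" if m: "m \<in> L" and uv: "(u, v) \<in> conn m e" for m u v
    using uv
  proof (rule conn_retract)
    show "refl (rel m \<union> Id)" by (auto simp: refl_on_def)
    show "trans (rel m \<union> Id)" using rel_trans[OF L(1)[OF m]] by (auto simp: trans_def)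
    show "(r (lv 0 1 x), r (lv 0 1 y)) \<in> rel m \<union> Id" if "(x, y) \<in> rel m" for x y
    proof (cases "x \<in> Z \<or> y \<in> Z")
      case True
      then have "x = y" using iso[OF m] that by blast
      then show ?thesis by simp
    next
      case False
      then show ?thesis using that by (simp add: r_def lv_def)
    qed
    show "(r (lv 1 2 x), r (lv 1 2 y)) \<in> rel m \<union> Id" if "(x, y) \<in> rel e" for x y
    proof -
      have "(q x, q y) \<in> E" "x \<in> nodes n" "y \<in> nodes n" using that by (auto simp: rel_e Q_def)
      moreover have "r (lv 1 2 z) = q z" if "z \<in> nodes n" for z
        using that by (auto simp: r_def lv_def q_def in_nodes_iff)
      ultimately show ?thesis using m by (auto simp: E_def)
    qed
  qed
  have e_conn: "(lv 1 2 x, lv 1 2 y) \<in> conn m e" if "x \<in> nodes n" "y \<in> nodes n" "q x = q y" for m x y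
    using that by (intro conn_right) (simp add: rel_e Q_def E_def)
  have through: "((1, x), (2, x)) \<in> conn m e" if "x \<in> {1..int n}" "x \<notin> Z" for m x
    using e_conn[of "- x" x m] that by (simp add: q_def lv_def in_nodes_iff)
  have id: "dcomp n m e = m" if m: "m \<in> L" for m
  proof -
    note mD = L(1)[OF m]
    have "(lv 0 2 x, lv 0 2 y) \<in> conn m e \<longleftrightarrow> (x, y) \<in> rel m" if xy: "x \<in> nodes n" "y \<in> nodes n" for x y
    proof
      assume "(lv 0 2 x, lv 0 2 y) \<in> conn m e"
      then have "(r (lv 0 2 x), r (lv 0 2 y)) \<in> rel m \<union> Id" by (rule retract[OF m])
      then have "(x, y) \<in> rel m \<union> Id" by (simp add: r_def lv_def split: if_splits)
      then show "(x, y) \<in> rel m" using rel_refl[OF mD] xy by auto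
    next
      assume rel: "(x, y) \<in> rel m"
      show "(lv 0 2 x, lv 0 2 y) \<in> conn m e"
      proof (cases "x \<in> Z \<or> y \<in> Z")
        case True
        then have "x = y" using iso[OF m] rel by blast
        then show ?thesis by (simp add: conn_refl)
      next
        case False
        have "(lv 0 1 z, lv 0 2 z) \<in> conn m e" if "z \<in> nodes n" "z \<notin> Z" for z
        proof (cases "z < 0")
          case True
          then show ?thesis by (simp add: lv_def conn_refl)
        next
          case False
          then show ?thesis using through[of z m] that by (simp add: lv_def in_nodes_iff)
        qed
        then show ?thesis
          using False xy conn_left[OF rel, of e] conn_sym conn_trans by meson
      qed
    qed
    then have "rel (dcomp n m e) = rel m"
      using rel_nodes[OF mD] unfolding rel_dcomp[OF mD e] by auto
    then show ?thesis by (rule diagram_eqI[OF dcomp_diagram[OF mD e] mD])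
  qed
  \<comment> \<open>Middle nodes outside \<open>Z\<close> reach their copy on the right, and those
    in \<open>Z\<close> reach \<open>w\<close> if it is a node; otherwise they form a single loop.
    The count does not depend on \<open>m\<close>, so one \<open>\<kappa>\<close> serves all of
    \<open>L\<close>.\<close>
  have loops: "nloops n m e = (if w = 0 \<and> Z \<noteq> {} then 1 else 0)" if m: "m \<in> L" for m
  proof -
    note mD = L(1)[OF m]
    have esc: "\<not> conn m e `` {(1, x)} \<subseteq> mid 1 n" if "x \<in> {1..int n}" "x \<notin> Z \<or> w \<noteq> 0" for x
    proof (cases "x \<in> Z")
      case False
      then show ?thesis using through[OF that(1), of m] by (auto simp: mid_def)
    next
      case True
      then have w': "w \<in> {1..int n}" using that w by auto
      then have "((1, x), (2, w)) \<in> conn m e"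
        using e_conn[of "- x" w m] that True by (simp add: q_def lv_def in_nodes_iff)
      then show ?thesis by (auto simp: mid_def)
    qed
    have closed: "conn m e `` {(1, x)} = Pair (1::nat) ` Z" if "x \<in> Z" "w = 0" for x
    proof (intro equalityI subsetI)
      fix v assume "v \<in> Pair (1::nat) ` Z"
      then obtain y where "y \<in> Z" "v = (1, y)" by blast
      moreover from this have "x \<in> {1..int n}" "y \<in> {1..int n}" using ZN that(1) by blast+
      ultimately have "((1, x), v) \<in> conn m e"
        using e_conn[of "- x" "- y" m] that by (simp add: q_def lv_def in_nodes_iff)
      then show "v \<in> conn m e `` {(1, x)}" by simp
    next
      fix v assume "v \<in> conn m e `` {(1, x)}"
      then have c: "((1, x), v) \<in> conn m e" by simp
      have "x \<in> {1..int n}" using ZN that(1) by blast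
      then have "v \<in> stack_vertices n"
        using conn_vertices[OF mD e c] by (simp add: stack_vertices_iff)
      \<comment> \<open>Since 0 is not a node, \<open>rel m\<close> relates it to nothing. So
        everything connected to \<open>x\<close> lies over 0, and the only such vertices are the
        middle nodes in \<open>Z\<close>.\<close>
      moreover have "r v = 0"
        using retract[OF m c] rel_nodes[OF mD, of 0 "r v"] that by (auto simp: r_def in_nodes_iff)
      ultimately show "v \<in> Pair (1::nat) ` Z"
        by (cases v) (auto simp: r_def stack_vertices_iff split: if_splits)
    qed
    have mid: "v \<in> mid 1 n \<longleftrightarrow> (\<exists>x\<in>{1..int n}. v = (1, x))" for v
      by (cases v) (auto simp: mid_def)
    have "closed_comps (conn m e) (mid 1 n) = (if w = 0 \<and> Z \<noteq> {} then {Pair (1::nat) ` Z} else {})"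
    proof (cases "w = 0 \<and> Z \<noteq> {}")
      case True
      have "Pair (1::nat) ` Z \<subseteq> mid 1 n" using ZN by (auto simp: mid_def)
      moreover obtain z where z: "z \<in> Z" using True by blast
      ultimately have "Pair (1::nat) ` Z \<in> closed_comps (conn m e) (mid 1 n)"
        unfolding closed_comps_def using closed[OF z] True
        by (intro CollectI exI[of _ "(1, z)"]) (use z in blast)
      moreover have "C = Pair (1::nat) ` Z" if "C \<in> closed_comps (conn m e) (mid 1 n)" for C
      proof -
        from that obtain v where "v \<in> mid 1 n" "C = conn m e `` {v}" "C \<subseteq> mid 1 n"
          unfolding closed_comps_def by blast
        moreover from this(1) obtain x where "x \<in> {1..int n}" "v = (1, x)" unfolding mid by blast
        ultimately have "x \<in> {1..int n}" "C = conn m e `` {(1, x)}" "C \<subseteq> mid 1 n" by simp_all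
        then show ?thesis using esc[of x] closed[of x] True by metis
      qed
      ultimately have "closed_comps (conn m e) (mid 1 n) = {Pair (1::nat) ` Z}" by blast
      then show ?thesis using True by simp
    next
      case False
      then have "x \<notin> Z \<or> w \<noteq> 0" for x by auto
      then have "\<not> conn m e `` {v} \<subseteq> mid 1 n" if "v \<in> mid 1 n" for v
        using that esc unfolding mid by blast
      then have "closed_comps (conn m e) (mid 1 n) = {}" unfolding closed_comps_def by blast
      then show ?thesis using False by simp
    qed
    then show ?thesis by (simp add: nloops_closed_comps[OF mD e])
  qed
  have "\<exists>\<kappa>. \<kappa> * \<delta> ^ (if w = 0 \<and> Z \<noteq> {} then 1 else 0) = 1"
  proof (cases "w = 0 \<and> Z \<noteq> {}")
    case True
    then obtain u where "\<delta> * u = 1" using w0 by blast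
    then show ?thesis using True by (intro exI[of _ u]) (simp add: mult.commute)
  next
    case False
    show ?thesis by (intro exI[of _ 1]) (simp only: False if_False power_0 mult_1)
  qed
  then obtain \<kappa> where "\<kappa> * \<delta> ^ (if w = 0 \<and> Z \<noteq> {} then 1 else 0) = 1" by blast
  with eL id loops show ?thesis unfolding L_def[symmetric] by (intro exI[of _ e] exI[of _ \<kappa>]) simp
qed

section \<open>The bar complex\<close>

lemma twisted_monoid_diagrams:
  "twisted_monoid (diagrams n) (dcomp n) (\<lambda>a b. \<delta> ^ nloops n a b :: 'r::comm_ring_1)
     (\<lambda>d. of_bool (perm_diagram d))"
  by unfold_locales
     (simp_all add: finite_diagrams dcomp_diagram dcomp_assoc aug_mult power_add[symmetric]
       nloops_cocycle)

theorem theorem4p2: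
  fixes \<delta> :: "'r::comm_ring_1" and n :: nat and X :: "nat set"
  assumes "X \<subseteq> {1..n}"
    and "(\<exists>u. \<delta> * u = 1) \<or> card X < n"
  shows "\<forall>i > 0. Tor_triv_quot_vanishes n \<delta> X i"
proof (intro allI impI)
  fix k :: nat assume k: "k > 0"
  interpret P: twisted_monoid "diagrams n" "dcomp n" "\<lambda>a b. \<delta> ^ nloops n a b"
    "\<lambda>d. of_bool (perm_diagram d)"
    by (rule twisted_monoid_diagrams)
  have Xc: "x \<in> {1..n}" "y \<in> {1..n}" if "(x, y) \<in> X \<times> X" for x y
    using that assms(1) by auto
  have "P.exact_at (diagrams n - \<Union>(Lc n ` (X \<times> X))) k"
  proof (rule P.exact_at_complement)
    show "P.left_stable (Lc n c)" if "c \<in> X \<times> X" for c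
      using that Xc by (cases c)
        (auto simp: P.left_stable_def Lc_def sat_dcomp dcomp_diagram simp del: sat.simps)
    show "finite (X \<times> X)" using finite_subset[OF assms(1)] by simp
    show "of_bool (perm_diagram m) = (0 :: 'r)" if "c \<in> X \<times> X" "m \<in> Lc n c" for c m
    proof -
      obtain x y where "c = (x, y)" by (cases c)
      then have "\<not> perm_diagram m" using that Xc[of x y] sat_not_perm[of m n x y]
        by (auto simp: Lc_def simp del: sat.simps)
      then show ?thesis by simp
    qed
    show "\<exists>e \<kappa>. e \<in> diagrams n \<inter> \<Inter>(Lc n ` T) \<and>
        (\<forall>m\<in>diagrams n \<inter> \<Inter>(Lc n ` T). dcomp n m e = m \<and> \<kappa> * \<delta> ^ nloops n m e = 1)"
      if "T \<subseteq> X \<times> X" "diagrams n \<inter> \<Inter>(Lc n ` T) \<noteq> {}" for T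
      using that by (rule idempotent_exists[OF assms])
  qed (rule k)
  moreover have "diagrams n - \<Union>(Lc n ` (X \<times> X)) = Mbasis n X"
    by (auto simp: Mbasis_def inJ_sat Lc_def simp del: sat.simps)
  ultimately have exact: "P.exact_at (Mbasis n X) k" by simp
  \<comment> \<open>The given complex, indexed by pairs, is now matched with the complex on lists
    through \<open>ds @ [m]\<close>.\<close>
  have basis: "ds @ [m] \<in> P.lists_of k \<inter> P.ends_in (Mbasis n X) \<longleftrightarrow> (ds, m) \<in> chain_basis n X k"
    for ds m k
    by (auto simp: P.lists_of_def P.ends_in_def chain_basis_def Mbasis_def)
  have coeff: "bar_diff_basis n \<delta> X (ds, m) (es, m') =
      (if m' \<in> Mbasis n X then P.bcoeff k (ds @ [m]) (es @ [m']) else 0)"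
    if dm: "(ds, m) \<in> chain_basis n X k" for ds m es m' k
  proof (cases k)
    case 0
    then show ?thesis using dm
      by (auto simp: chain_basis_def bar_diff_basis_def P.bcoeff_def)
  next
    case (Suc j)
    have len: "length ds = Suc j" and m: "m \<in> Mbasis n X" and D: "set ds \<subseteq> diagrams n"
      using dm Suc by (auto simp: chain_basis_def)
    then have ne: "ds \<noteq> []" by auto
    have prod: "dcomp n (last ds) m \<in> Mbasis n X \<longleftrightarrow> \<not> inJ X (dcomp n (last ds) m)"
      using last_in_set[OF ne] D m dcomp_diagram[of "last ds" n m] by (auto simp: Mbasis_def)
    define F where "F i = (- 1) ^ i * (P.face_wt i (ds @ [m]) *
      (of_bool (es @ [m'] = P.face i (ds @ [m])) :: 'r))" for i
    \<comment> \<open>Face 0 is the augmentation term, the last face is the action on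
      \<open>m\<close>, and the faces between are the products inside \<open>ds\<close>.\<close>
    have "{..Suc j} = insert 0 (insert (Suc j) {1..<Suc j})" by auto
    then have "P.bcoeff k (ds @ [m]) (es @ [m']) = F 0 + (\<Sum>i\<in>{1..<Suc j}. F i) + F (Suc j)"
      unfolding P.bcoeff_def Suc F_def[symmetric] by (simp add: algebra_simps)
    moreover have "F 0 = (if perm_diagram (hd ds) \<and> (es, m') = (tl ds, m) then 1 else 0)"
      using ne by (auto simp: F_def)
    moreover have "F (Suc j) = (if (es, m') = (butlast ds, dcomp n (last ds) m)
        then (- 1) ^ length ds * \<delta> ^ nloops n (last ds) m else 0)"
      unfolding F_def using len by (simp add: P.face_last P.face_wt_last)
    moreover have "F i = (if (es, m') = (take (i - 1) ds @ [dcomp n (ds ! (i - 1)) (ds ! i)] @ drop (i + 1) ds, m)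
        then (- 1) ^ i * \<delta> ^ nloops n (ds ! (i - 1)) (ds ! i) else 0)" if "i \<in> {1..<Suc j}" for i
    proof -
      \<comment> \<open>Face \<open>Suc i'\<close> merges positions \<open>i'\<close> and
        \<open>Suc i'\<close>, counted from 0. Both lie inside \<open>ds\<close>, so the appended
        \<open>m\<close> is untouched.\<close>
      from that obtain i' where i: "i = Suc i'" by (cases i) auto
      then have "i < length ds" using that len by simp
      then show ?thesis
        using i by (simp add: F_def P.face_append P.face_wt_append P.face_Suc P.face_wt_Suc One_nat_def)
    qed
    ultimately have bcoeff: "P.bcoeff k (ds @ [m]) (es @ [m']) =
        (if perm_diagram (hd ds) \<and> (es, m') = (tl ds, m) then 1 else 0)
        + (\<Sum>i\<in>{1..<Suc j}. if (es, m') = (take (i - 1) ds @ [dcomp n (ds ! (i - 1)) (ds ! i)] @ drop (i + 1) ds, m)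
            then (- 1) ^ i * \<delta> ^ nloops n (ds ! (i - 1)) (ds ! i) else 0)
        + (if (es, m') = (butlast ds, dcomp n (last ds) m)
            then (- 1) ^ length ds * \<delta> ^ nloops n (last ds) m else 0)"
      by (simp only: cong: sum.cong)
    show ?thesis
    proof (cases "m' \<in> Mbasis n X")
      case True
      then have "(es, m') = (butlast ds, dcomp n (last ds) m) \<longleftrightarrow>
          \<not> inJ X (dcomp n (last ds) m) \<and> (es, m') = (butlast ds, dcomp n (last ds) m)"
        using prod by blast
      then show ?thesis
        using True ne unfolding bcoeff by (simp only: bar_diff_basis_def prod.case len if_True simp_thms)
    next
      case False
      \<comment> \<open>Every term keeps the module entry \<open>m\<close> or replaces it by a
        product in the basis, so no term can end in an \<open>m'\<close> outside the basis.\<close>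
      then have "m' \<noteq> m" "\<not> (\<not> inJ X (dcomp n (last ds) m) \<and> m' = dcomp n (last ds) m)"
        using m prod by blast+
      then show ?thesis
        using False by (auto simp: bar_diff_basis_def)
    qed
  qed
  \<comment> \<open>The empty list corresponds to no pair and receives the value 0.\<close>
  define ext where "ext f xs = (if xs = [] then 0 else f (butlast xs, last xs))"
    for f :: "bar_index \<Rightarrow> 'r" and xs
  have bar_d: "bar_d n \<delta> X k f (es, m') =
      (if m' \<in> Mbasis n X then P.bd k (ext f) (es @ [m']) else 0)"
    if f: "f \<in> bar_chains n X k" for f es m' k
  proof -
    have "P.bd k (ext f) (es @ [m']) =
        (\<Sum>xs\<in>(\<lambda>(ds, m). ds @ [m]) ` chain_basis n X k. ext f xs * P.bcoeff k xs (es @ [m']))"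
      unfolding P.bd_def
    proof (rule sum.mono_neutral_right[OF P.finite_lists_of])
      show "(\<lambda>(ds, m). ds @ [m]) ` chain_basis n X k \<subseteq> P.lists_of k"
        using basis by auto
      show "\<forall>xs\<in>P.lists_of k - (\<lambda>(ds, m). ds @ [m]) ` chain_basis n X k.
          ext f xs * P.bcoeff k xs (es @ [m']) = 0"
      proof
        fix xs assume xs: "xs \<in> P.lists_of k - (\<lambda>(ds, m). ds @ [m]) ` chain_basis n X k"
        show "ext f xs * P.bcoeff k xs (es @ [m']) = 0"
        proof (cases xs rule: rev_cases)
          case (snoc ds m)
          with xs have "(ds, m) \<notin> chain_basis n X k" by auto
          then show ?thesis using snoc f by (simp add: ext_def bar_chains_def)
        qed (simp add: ext_def)
      qed
    qed
    also have "\<dots> = (\<Sum>x\<in>chain_basis n X k. f x * P.bcoeff k (fst x @ [snd x]) (es @ [m']))"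
      by (subst sum.reindex) (auto simp: inj_on_def ext_def case_prod_unfold)
    finally show ?thesis
      unfolding bar_d_def using coeff by (auto intro!: sum.cong sum.neutral)
  qed
  have ext_chains: "ext f \<in> P.chains (Mbasis n X) k" if "f \<in> bar_chains n X k" for f
    unfolding P.chains_def
  proof (intro CollectI allI impI)
    fix xs assume "xs \<notin> P.lists_of k \<inter> P.ends_in (Mbasis n X)"
    then show "ext f xs = 0"
      using that basis[of _ _ k] by (cases xs rule: rev_cases) (auto simp: ext_def bar_chains_def)
  qed
  show "Tor_triv_quot_vanishes n \<delta> X k"
    unfolding Tor_triv_quot_vanishes_def
  proof (intro ballI impI)
    fix f :: "bar_index \<Rightarrow> 'r"
    assume f: "f \<in> bar_chains n X k" and cycle: "\<forall>y. bar_d n \<delta> X k f y = 0"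
    have "P.bd k (ext f) ys = 0" if "ys \<in> P.ends_in (Mbasis n X)" for ys
    proof -
      from that obtain es m' where "ys = es @ [m']" "m' \<in> Mbasis n X"
        by (cases ys rule: rev_cases) (auto simp: P.ends_in_def)
      then show ?thesis using bar_d[OF f, of es m'] cycle by simp
    qed
    then obtain h where h: "h \<in> P.chains (Mbasis n X) (Suc k)"
      and dh: "\<And>ys. ys \<in> P.ends_in (Mbasis n X) \<Longrightarrow> P.bd (Suc k) h ys = ext f ys"
      using exact ext_chains[OF f] unfolding P.exact_at_def by blast
    define g where "g x = h (fst x @ [snd x])" for x
    have g: "g \<in> bar_chains n X (Suc k)"
      unfolding bar_chains_def
    proof (intro CollectI allI impI)
      fix x assume "x \<notin> chain_basis n X (Suc k)"
      then have "fst x @ [snd x] \<notin> P.lists_of (Suc k) \<inter> P.ends_in (Mbasis n X)"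
        unfolding basis by simp
      then show "g x = 0" using h unfolding g_def P.chains_def by blast
    qed
    have "ext g = h"
    proof
      fix xs
      show "ext g xs = h xs"
        using h by (cases xs rule: rev_cases) (auto simp: ext_def g_def P.chains_def P.ends_in_def)
    qed
    have "bar_d n \<delta> X (Suc k) g = f"
    proof
      fix y :: bar_index
      obtain es m' where y: "y = (es, m')" by (cases y)
      show "bar_d n \<delta> X (Suc k) g y = f y"
      proof (cases "m' \<in> Mbasis n X")
        case True
        then show ?thesis
          using dh[of "es @ [m']"] \<open>ext g = h\<close>
          by (simp add: y bar_d[OF g] P.ends_in_def ext_def)
      next
        case False
        then have "y \<notin> chain_basis n X k" by (simp add: y chain_basis_def)
        then show ?thesis using False f by (simp add: y bar_d[OF g] bar_chains_def)
      qed
    qed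
    with g show "\<exists>g\<in>bar_chains n X (Suc k). bar_d n \<delta> X (Suc k) g = f" by blast
  qed
qed

end
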